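(* Let $\mathcal{G}=(X,*,\mathrm{typ})$ be a geometry over some finite set $I$ and let $G$ be a group of automorphisms of $\mathcal{G}$. For each $i\in I$ let $w^i_1,\ldots,w^i_{t_i}$ be $G$-orbit representatives of the elements of type $i$ of $\mathcal{G}$ such that (i) $W:=\bigcup_{i\in I}\{w^i_1,\ldots,w^i_{t_i}\}$ is a hall, and (ii) if $V\subseteq W$ is a flag, the action of $G$ on the pregeometry over $\mathrm{typ}(V)$ consisting of all elements of the $G$-orbits $G.x$, $x\in V$, is flag-transitive. Let $\mathcal{W}\subseteq 2^W$ be a shape, assume that for each flag $U\in 2^W\setminus\mathcal{W}$ the residue $\mathcal{G}_U$ is simply connected, and let $\mathcal{A}(\mathcal{G},G,W)$ and $\mathcal{A}_{\mathcal{W}}(\mathcal{G},G,W)$ be the amalgam of maximal parabolics, respectively the amalgam of shape $\mathcal{W}$, of $\mathcal{G}$ with respect to $G$ and $W$. Then $$G=\mathcal{U}(\mathcal{A}_{\mathcal{W}}(\mathcal{G},G,W)).$$ In particular, if $\emptyset\notin\mathcal{W}$, we have $$G=\mathcal{U}(\mathcal{A}(\mathcal{G},G,W))=\mathcal{U}(\mathcal{A}_{\mathcal{W}}(\mathcal{G},G,W)).$$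
   Context: A pregeometry over a set $I$ is a triple $(X,*,\mathrm{typ})$ with a set $X$, a symmetric reflexive incidence relation $*$ on $X$ and a surjection $\mathrm{typ}:X\to I$ such that $x*y$ and $\mathrm{typ}(x)=\mathrm{typ}(y)$ imply $x=y$. A flag is a set of pairwise incident elements (the empty set is a flag); a chamber is a flag $F$ with $\mathrm{typ}(F)=I$. A geometry is a pregeometry in which every flag is contained in a chamber. It is connected if the graph $(X,* )$ is connected. A subset $W\subseteq X$ is a hall if $\mathrm{typ}(W)=I$ and every $V\subseteq W$ on which $\mathrm{typ}$ is injective is a flag. The residue $\mathcal{G}_F$ of a flag $F$ is the pregeometry of all $x\in X$ with $\mathrm{typ}(x)\notin\mathrm{typ}(F)$ and $F\cup\{x\}$ a flag, with induced incidence and type function; $\mathcal{G}_\emptyset=\mathcal{G}$. An automorphism is a type-preserving permutation of $X$ preserving incidence in both directions; a group of automorphisms is a subgroup of $\mathrm{Aut}(\mathcal{G})$. An action by automorphisms is flag-transitive if any two flags of the same type are in one orbit. A shape is a set $\mathcal{W}\subseteq 2^W$ of flags such that if $U\in\mathcal{W}$ and $U'\subseteq W$ is a flag with $U'\supseteq U$ then $U'\in\mathcal{W}$. For a flag $U\subseteq W$ let $G_U$ be the stabilizer of $U$ in $G$ (fixing every element of $U$; $G_\emptyset=G$). The amalgam of shape $\mathcal{W}$, $\mathcal{A}_{\mathcal{W}}(\mathcal{G},G,W)$, is the family $(G_U)_{U\in\mathcal{W}}$ with the inclusions $G_{U'}\hookrightarrow G_U$ for $U\subseteq U'$ as identification maps.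 $\mathcal{A}(\mathcal{G},G,W)$ is the amalgam of the shape consisting of all nonempty flags contained in $W$. The universal completion $\mathcal{U}(\mathcal{A})$ of such an amalgam is the group with one generator $u_g$ for every element $g$ of the disjoint union of its groups, with relations $u_xu_y=u_z$ whenever $xy=z$ in one of the groups, and $u_x=u_y$ whenever an identification map sends $x$ to $y$. An equality $G=\mathcal{U}(\mathcal{A})$ means that the canonical homomorphism $\mathcal{U}(\mathcal{A})\to G$, $u_g\mapsto g$, is an isomorphism. Homotopy: a path is a sequence $(x_0,\ldots,x_k)$ of elements with consecutive ones incident; a cycle based at $x$ is a path with $x_0=x_k=x$. Two paths are homotopically equivalent if one is obtained from the other by finitely many insertions or deletions of cycles of length 1, 2 or 3. The fundamental group at $x$ is the group of equivalence classes of cycles based at $x$ under concatenation. A (pre)geometry is simply connected if it is connected and its fundamental group is trivial. *)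

theory Defs
  imports "HOL-Algebra.Group_Action" "HOL-Algebra.Elementary_Groups"
begin

section \<open>Pregeometries and geometries\<close>

record ('a, 'i) pregeom =
  elts :: "'a set"
  incid :: "'a rel"
  type_of :: "'a \<Rightarrow> 'i"

definition pregeometry :: "'i set \<Rightarrow> ('a, 'i) pregeom \<Rightarrow> bool" where
  "pregeometry I \<Gamma> \<longleftrightarrow>
     incid \<Gamma> \<subseteq> elts \<Gamma> \<times> elts \<Gamma> \<and>
     refl_on (elts \<Gamma>) (incid \<Gamma>) \<and>
     sym (incid \<Gamma>) \<and>
     type_of \<Gamma> ` elts \<Gamma> = I \<and>
     (\<forall>x y. (x, y) \<in> incid \<Gamma> \<and> type_of \<Gamma> x = type_of \<Gamma> y \<longrightarrow> x = y)"

definition flag :: "('a, 'i) pregeom \<Rightarrow> 'a set \<Rightarrow> bool" where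
  "flag \<Gamma> F \<longleftrightarrow> F \<subseteq> elts \<Gamma> \<and> (\<forall>x\<in>F. \<forall>y\<in>F. (x, y) \<in> incid \<Gamma>)"

definition chamber :: "'i set \<Rightarrow> ('a, 'i) pregeom \<Rightarrow> 'a set \<Rightarrow> bool" where
  "chamber I \<Gamma> F \<longleftrightarrow> flag \<Gamma> F \<and> type_of \<Gamma> ` F = I"

definition geometry :: "'i set \<Rightarrow> ('a, 'i) pregeom \<Rightarrow> bool" where
  "geometry I \<Gamma> \<longleftrightarrow> pregeometry I \<Gamma> \<and> (\<forall>F. flag \<Gamma> F \<longrightarrow> (\<exists>C. chamber I \<Gamma> C \<and> F \<subseteq> C))"

definition hall :: "'i set \<Rightarrow> ('a, 'i) pregeom \<Rightarrow> 'a set \<Rightarrow> bool" where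
  "hall I \<Gamma> W \<longleftrightarrow>
     W \<subseteq> elts \<Gamma> \<and> type_of \<Gamma> ` W = I \<and>
     (\<forall>V\<subseteq>W. inj_on (type_of \<Gamma>) V \<longrightarrow> flag \<Gamma> V)"

definition induced_pregeom :: "('a, 'i) pregeom \<Rightarrow> 'a set \<Rightarrow> ('a, 'i) pregeom" where
  "induced_pregeom \<Gamma> Y =
     \<lparr>elts = elts \<Gamma> \<inter> Y, incid = incid \<Gamma> \<inter> (Y \<times> Y), type_of = type_of \<Gamma>\<rparr>"

definition residue :: "('a, 'i) pregeom \<Rightarrow> 'a set \<Rightarrow> ('a, 'i) pregeom" where
  "residue \<Gamma> F =
     induced_pregeom \<Gamma>
       {x \<in> elts \<Gamma>. type_of \<Gamma> x \<notin> type_of \<Gamma> ` F \<and> flag \<Gamma> (F \<union> {x})}"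


section \<open>Simple connectedness\<close>

text \<open>The empty pregeometry (for example the residue of a chamber) counts as connected,
  and as simply connected, since it has no base points.\<close>

definition connected_pregeom :: "('a, 'i) pregeom \<Rightarrow> bool" where
  "connected_pregeom \<Gamma> \<longleftrightarrow> (\<forall>x\<in>elts \<Gamma>. \<forall>y\<in>elts \<Gamma>. (x, y) \<in> (incid \<Gamma>)\<^sup>*)"

text \<open>A path $(x_0,\ldots,x_k)$ is the list of its $k+1$ elements; its length is $k$.\<close>

definition is_path :: "('a, 'i) pregeom \<Rightarrow> 'a list \<Rightarrow> bool" where
  "is_path \<Gamma> p \<longleftrightarrow>
     p \<noteq> [] \<and> set p \<subseteq> elts \<Gamma> \<and> successively (\<lambda>x y. (x, y) \<in> incid \<Gamma>) p"

definition path_length :: "'a list \<Rightarrow> nat" where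
  "path_length p = length p - 1"

definition cycles_at :: "('a, 'i) pregeom \<Rightarrow> 'a \<Rightarrow> 'a list set" where
  "cycles_at \<Gamma> x = {c. is_path \<Gamma> c \<and> hd c = x \<and> last c = x}"

text \<open>Inserting a cycle based at $x$ into a path at an occurrence of $x$ replaces that
  occurrence by the whole cycle.\<close>

inductive cycle_insertion :: "('a, 'i) pregeom \<Rightarrow> 'a list \<Rightarrow> 'a list \<Rightarrow> bool"
  for \<Gamma> where
  "is_path \<Gamma> (p @ [x] @ q) \<Longrightarrow> c \<in> cycles_at \<Gamma> x \<Longrightarrow> path_length c \<in> {1, 2, 3} \<Longrightarrow>
   cycle_insertion \<Gamma> (p @ [x] @ q) (p @ c @ q)"

text \<open>The library's \<^const>\<open>equivclp\<close> is the equivalence relation generated by a relation.\<close>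

definition homotopic_cycles :: "('a, 'i) pregeom \<Rightarrow> 'a \<Rightarrow> 'a list rel" where
  "homotopic_cycles \<Gamma> x =
     {(p, q) \<in> cycles_at \<Gamma> x \<times> cycles_at \<Gamma> x. equivclp (cycle_insertion \<Gamma>) p q}"

definition fundamental_group :: "('a, 'i) pregeom \<Rightarrow> 'a \<Rightarrow> 'a list set monoid" where
  "fundamental_group \<Gamma> x =
     \<lparr>carrier = cycles_at \<Gamma> x // homotopic_cycles \<Gamma> x,
      mult = (\<lambda>A B. \<Union>p\<in>A. \<Union>q\<in>B. homotopic_cycles \<Gamma> x `` {p @ tl q}),
      one = homotopic_cycles \<Gamma> x `` {[x]}\<rparr>"

definition simply_connected_pregeom :: "('a, 'i) pregeom \<Rightarrow> bool" where
  "simply_connected_pregeom \<Gamma> \<longleftrightarrow>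
     connected_pregeom \<Gamma> \<and> (\<forall>x\<in>elts \<Gamma>. trivial_group (fundamental_group \<Gamma> x))"


section \<open>Automorphisms\<close>

definition aut_group :: "('a, 'i) pregeom \<Rightarrow> ('a \<Rightarrow> 'a) monoid" where
  "aut_group \<Gamma> = BijGroup (elts \<Gamma>)
     \<lparr>carrier := {g \<in> Bij (elts \<Gamma>).
        (\<forall>x\<in>elts \<Gamma>. type_of \<Gamma> (g x) = type_of \<Gamma> x) \<and>
        (\<forall>x\<in>elts \<Gamma>. \<forall>y\<in>elts \<Gamma>. (g x, g y) \<in> incid \<Gamma> \<longleftrightarrow> (x, y) \<in> incid \<Gamma>)}\<rparr>"

abbreviation subaut :: "('a, 'i) pregeom \<Rightarrow> ('a \<Rightarrow> 'a) set \<Rightarrow> ('a \<Rightarrow> 'a) monoid" where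
  "subaut \<Gamma> G \<equiv> aut_group \<Gamma>\<lparr>carrier := G\<rparr>"

abbreviation aut_orbit :: "('a, 'i) pregeom \<Rightarrow> ('a \<Rightarrow> 'a) set \<Rightarrow> 'a \<Rightarrow> 'a set" where
  "aut_orbit \<Gamma> G x \<equiv> orbit (subaut \<Gamma> G) (\<lambda>g. g) x"

definition flag_stabilizer :: "('a \<Rightarrow> 'a) set \<Rightarrow> 'a set \<Rightarrow> ('a \<Rightarrow> 'a) set" where
  "flag_stabilizer G U = {g \<in> G. \<forall>x\<in>U. g x = x}"

text \<open>In the following definition \<open>\<Delta>\<close> may be a \<open>G\<close>-invariant part of the
  pregeometry on which \<open>G\<close> is given as a group of automorphisms.\<close>

definition flag_transitive_on :: "('a \<Rightarrow> 'a) set \<Rightarrow> ('a, 'i) pregeom \<Rightarrow> bool" where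
  "flag_transitive_on G \<Delta> \<longleftrightarrow>
     (\<forall>F F'. flag \<Delta> F \<and> flag \<Delta> F' \<and> type_of \<Delta> ` F = type_of \<Delta> ` F' \<longrightarrow> (\<exists>g\<in>G. g ` F = F'))"

definition orbit_representatives ::
    "('a, 'i) pregeom \<Rightarrow> ('a \<Rightarrow> 'a) set \<Rightarrow> 'i \<Rightarrow> nat \<Rightarrow> (nat \<Rightarrow> 'a) \<Rightarrow> bool" where
  "orbit_representatives \<Gamma> G i n w \<longleftrightarrow>
     (\<forall>j\<in>{1..n}. w j \<in> elts \<Gamma> \<and> type_of \<Gamma> (w j) = i) \<and>
     (\<forall>x\<in>elts \<Gamma>. type_of \<Gamma> x = i \<longrightarrow> (\<exists>!j. j \<in> {1..n} \<and> x \<in> aut_orbit \<Gamma> G (w j)))"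


section \<open>Groups given by generators and relations\<close>

text \<open>Words are lists of letters \<open>(b, s)\<close>, standing for the generator \<open>s\<close> if \<open>b\<close> holds
  and for its formal inverse otherwise. A pair \<open>(r, r')\<close> of words is the relation
  $r = r'$.\<close>

type_synonym 's word = "(bool \<times> 's) list"

abbreviation words :: "'s set \<Rightarrow> 's word set" where
  "words S \<equiv> lists (UNIV \<times> S)"

inductive word_step :: "'s set \<Rightarrow> 's word rel \<Rightarrow> 's word \<Rightarrow> 's word \<Rightarrow> bool"
  for S R where
  cancel: "u \<in> words S \<Longrightarrow> v \<in> words S \<Longrightarrow> s \<in> S \<Longrightarrow>
     word_step S R (u @ [(b, s), (\<not> b, s)] @ v) (u @ v)"
| relation: "u \<in> words S \<Longrightarrow> v \<in> words S \<Longrightarrow> (r, r') \<in> R \<Longrightarrow>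
     word_step S R (u @ r @ v) (u @ r' @ v)"

definition word_equiv :: "'s set \<Rightarrow> 's word rel \<Rightarrow> 's word rel" where
  "word_equiv S R = {(p, q) \<in> words S \<times> words S. equivclp (word_step S R) p q}"

definition presented_group :: "'s set \<Rightarrow> 's word rel \<Rightarrow> 's word set monoid" where
  "presented_group S R =
     \<lparr>carrier = words S // word_equiv S R,
      mult = (\<lambda>A B. \<Union>p\<in>A. \<Union>q\<in>B. word_equiv S R `` {p @ q}),
      one = word_equiv S R `` {[]}\<rparr>"

fun eval_word :: "('h, 'm) monoid_scheme \<Rightarrow> ('s \<Rightarrow> 'h) \<Rightarrow> 's word \<Rightarrow> 'h" where
  "eval_word H f [] = \<one>\<^bsub>H\<^esub>"
| "eval_word H f ((b, s) # w) = (if b then f s else inv\<^bsub>H\<^esub> (f s)) \<otimes>\<^bsub>H\<^esub> eval_word H f w"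


section \<open>Amalgams and universal completions\<close>

text \<open>There is an identification map \<open>amap j k\<close> from \<open>grp j\<close> to \<open>grp k\<close> for each
  pair \<open>(j, k)\<close> in \<open>arrows\<close>.\<close>

record ('j, 'g) amalgam =
  index :: "'j set"
  grp :: "'j \<Rightarrow> 'g monoid"
  arrows :: "'j rel"
  amap :: "'j \<Rightarrow> 'j \<Rightarrow> 'g \<Rightarrow> 'g"

definition amalgam_gens :: "('j, 'g) amalgam \<Rightarrow> ('j \<times> 'g) set" where
  "amalgam_gens A = (SIGMA j : index A. carrier (grp A j))"

definition amalgam_rels :: "('j, 'g) amalgam \<Rightarrow> ('j \<times> 'g) word rel" where
  "amalgam_rels A =
     {([(True, (j, x)), (True, (j, y))], [(True, (j, x \<otimes>\<^bsub>grp A j\<^esub> y))]) | j x y.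
        j \<in> index A \<and> x \<in> carrier (grp A j) \<and> y \<in> carrier (grp A j)} \<union>
     {([(True, (j, x))], [(True, (k, amap A j k x))]) | j k x.
        (j, k) \<in> arrows A \<and> x \<in> carrier (grp A j)}"

definition universal_completion :: "('j, 'g) amalgam \<Rightarrow> ('j \<times> 'g) word set monoid" where
  "universal_completion A = presented_group (amalgam_gens A) (amalgam_rels A)"

definition completion_gen :: "('j, 'g) amalgam \<Rightarrow> 'j \<times> 'g \<Rightarrow> ('j \<times> 'g) word set" where
  "completion_gen A s = word_equiv (amalgam_gens A) (amalgam_rels A) `` {[(True, s)]}"

text \<open>The homomorphism from the universal completion to \<open>H\<close> that extends the assignment
  \<open>f\<close> of elements of \<open>H\<close> to the generators; it is well-defined if \<open>f\<close> respects the
  defining relations, as is the case for the two instances below.\<close>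

definition completion_hom ::
    "('j, 'g) amalgam \<Rightarrow> ('h, 'm) monoid_scheme \<Rightarrow> ('j \<times> 'g \<Rightarrow> 'h) \<Rightarrow> ('j \<times> 'g) word set \<Rightarrow> 'h" where
  "completion_hom A H f C = the_elem (eval_word H f ` C)"

text \<open>$H = \mathcal{U}(\mathcal{A})$, for an amalgam all of whose groups are subgroups of
  \<open>H\<close>.\<close>

definition is_universal_completion :: "('g, 'm) monoid_scheme \<Rightarrow> ('j, 'g) amalgam \<Rightarrow> bool" where
  "is_universal_completion H A \<longleftrightarrow>
     completion_hom A H snd \<in> iso (universal_completion A) H"

text \<open>$\mathcal{U}(\mathcal{B}) = \mathcal{U}(\mathcal{A})$, for an amalgam \<open>A\<close> contained in
  \<open>B\<close>: the canonical homomorphism $\mathcal{U}(\mathcal{A}) \to \mathcal{U}(\mathcal{B})$,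
  $u_g \mapsto u_g$, is an isomorphism.\<close>

definition same_completion :: "('j, 'g) amalgam \<Rightarrow> ('j, 'g) amalgam \<Rightarrow> bool" where
  "same_completion B A \<longleftrightarrow>
     completion_hom A (universal_completion B) (completion_gen B)
       \<in> iso (universal_completion A) (universal_completion B)"


section \<open>Shapes\<close>

definition shape :: "('a, 'i) pregeom \<Rightarrow> 'a set \<Rightarrow> 'a set set \<Rightarrow> bool" where
  "shape \<Gamma> W \<W> \<longleftrightarrow>
     (\<forall>U\<in>\<W>. U \<subseteq> W \<and> flag \<Gamma> U) \<and>
     (\<forall>U\<in>\<W>. \<forall>U'. U' \<subseteq> W \<and> flag \<Gamma> U' \<and> U \<subseteq> U' \<longrightarrow> U' \<in> \<W>)"

text \<open>The set \<open>W\<close> enters the amalgam of shape \<open>\<W>\<close> only through the shape.\<close>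

definition shape_amalgam ::
    "('a, 'i) pregeom \<Rightarrow> ('a \<Rightarrow> 'a) set \<Rightarrow> 'a set set \<Rightarrow> ('a set, 'a \<Rightarrow> 'a) amalgam" where
  "shape_amalgam \<Gamma> G \<W> =
     \<lparr>index = \<W>,
      grp = (\<lambda>U. subaut \<Gamma> (flag_stabilizer G U)),
      arrows = {(U', U). U' \<in> \<W> \<and> U \<in> \<W> \<and> U \<subseteq> U'},
      amap = (\<lambda>U' U g. g)\<rparr>"

definition parabolic_amalgam ::
    "('a, 'i) pregeom \<Rightarrow> ('a \<Rightarrow> 'a) set \<Rightarrow> 'a set \<Rightarrow> ('a set, 'a \<Rightarrow> 'a) amalgam" where
  "parabolic_amalgam \<Gamma> G W = shape_amalgam \<Gamma> G {U. U \<subseteq> W \<and> flag \<Gamma> U \<and> U \<noteq> {}}"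

end

theory Submission
  imports Defs
begin

text \<open>
  The hall condition together with flag-transitivity makes \<open>W\<close> a strict fundamental domain: each
  flag of the geometry can be moved by \<open>G\<close> to a unique flag contained in \<open>W\<close>. The same is true of
  the action of the stabilizer of a flag \<open>U \<subseteq> W\<close> on the residue of \<open>U\<close>.

  The core is Tits' lemma for a group that acts on a simply connected pregeometry with a strict
  fundamental domain: homomorphisms from the vertex stabilizers to a group \<open>H\<close> that agree on
  intersections for incident vertices of \<open>W\<close> extend to the whole group, uniquely if there are
  vertices at all. Such a family of homomorphisms defines a principal \<open>H\<close>-bundle over
  the pregeometry. Edges identify the fibres over their ends, and this is consistent around
  triangles, because edges and triangles can be moved into \<open>W\<close>. Only cycles of length at most three
  are needed to contract any cycle, so the bundle has a flat global section
  (\<open>simply_connected_imp_coboundary\<close>, \<open>flat_section\<close>). By connectedness, translating this section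
  by a group element changes it by a constant of \<open>H\<close>; these constants form the extension
  (\<open>simply_connected_extension\<close>). Uniqueness holds since the vertex stabilizers generate
  (\<open>stabilizers_generate\<close>), which uses connectedness alone.

  For a shape, one descends from large flags \<open>U\<close> to small ones. If \<open>U\<close> is in the shape, its
  stabilizer is a member of the amalgam. If not, Tits' lemma applies to the residue of \<open>U\<close>, in which
  the stabilizers of the vertices are the stabilizers of the flags \<open>insert w U\<close>, where the
  homomorphisms have already been extended (\<open>shape_homs_extend\<close>). For the empty flag this says that
  compatible homomorphisms from the amalgam extend to \<open>G\<close>. With the universal completion as target,
  the extension inverts the canonical homomorphism to \<open>G\<close> (\<open>universal_completion_shape\<close>).

  The nonempty flags contained in \<open>W\<close> form a shape to which this applies as well if
  the empty flag is not in the given one, and two completions that are canonically isomorphic to \<open>G\<close>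
  are canonically isomorphic to each other (\<open>same_completion_subshape\<close>).
\<close>


section \<open>Groups given by generators and relations\<close>

locale presentation =
  fixes S :: "'s set" and R :: "'s word rel"
  assumes rels_words: "R \<subseteq> words S \<times> words S"
begin

abbreviation word_class :: "'s word \<Rightarrow> 's word set" where
  "word_class p \<equiv> word_equiv S R `` {p}"

lemma word_step_words:
  assumes "word_step S R p q"
  shows "p \<in> words S" "q \<in> words S"
proof -
  have "p \<in> words S \<and> q \<in> words S"
    using assms
  proof cases
    case (relation u v r r')
    then have "r \<in> words S" "r' \<in> words S" using rels_words by blast+
    then show ?thesis using relation by simp
  qed simp
  then show "p \<in> words S" "q \<in> words S" by auto
qed

lemma word_equiv_trans:
  "(p, q) \<in> word_equiv S R \<Longrightarrow> (q, r) \<in> word_equiv S R \<Longrightarrow> (p, r) \<in> word_equiv S R"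
  unfolding word_equiv_def by (simp, elim conjE, rule equivclp_trans)

lemma equiv_word_equiv: "equiv (words S) (word_equiv S R)"
proof (rule equivI)
  show "refl_on (words S) (word_equiv S R)"
    by (auto simp: refl_on_def word_equiv_def equivclp_refl)
  show "sym (word_equiv S R)"
    unfolding sym_def word_equiv_def by (simp add: equivclp_sym)
  show "trans (word_equiv S R)"
    using word_equiv_trans by (rule transI)
qed (auto simp: word_equiv_def)

lemma word_equiv_refl: "p \<in> words S \<Longrightarrow> (p, p) \<in> word_equiv S R"
  by (simp add: word_equiv_def equivclp_refl)

lemma word_equiv_step: "word_step S R p q \<Longrightarrow> (p, q) \<in> word_equiv S R"
  using word_step_words[of p q] by (simp add: word_equiv_def r_into_equivclp)

lemma word_step_context:
  assumes "word_step S R p q" "u \<in> words S" "v \<in> words S"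
  shows "word_step S R (u @ p @ v) (u @ q @ v)"
  using assms(1)
proof cases
  case (cancel a b s c)
  have "word_step S R ((u @ a) @ [(c, s), (\<not> c, s)] @ (b @ v)) ((u @ a) @ (b @ v))"
    using cancel(3-5) assms(2,3) by (intro word_step.cancel) auto
  then show ?thesis unfolding cancel(1,2) append_assoc .
next
  case (relation a b r r')
  have "word_step S R ((u @ a) @ r @ (b @ v)) ((u @ a) @ r' @ (b @ v))"
    using relation(3-5) assms(2,3) by (intro word_step.relation) auto
  then show ?thesis unfolding relation(1,2) append_assoc .
qed

lemma word_equiv_context:
  assumes "(p, q) \<in> word_equiv S R" "u \<in> words S" "v \<in> words S"
  shows "(u @ p @ v, u @ q @ v) \<in> word_equiv S R"
proof -
  have "equivclp (word_step S R) p q" and pq: "p \<in> words S" "q \<in> words S"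
    using assms(1) by (auto simp: word_equiv_def)
  from this(1) have "equivclp (word_step S R) (u @ p @ v) (u @ q @ v)"
  proof (induction rule: equivclp_induct)
    case (step y z)
    then show ?case
      using word_step_context[OF _ assms(2,3)] by (meson equivclp_into_equivclp)
  qed (simp add: equivclp_refl)
  then show ?thesis using pq assms by (simp add: word_equiv_def)
qed

lemma word_equiv_append:
  assumes "(p, p') \<in> word_equiv S R" "(q, q') \<in> word_equiv S R"
  shows "(p @ q, p' @ q') \<in> word_equiv S R"
proof -
  have "p' \<in> words S" "q \<in> words S" using assms by (auto simp: word_equiv_def)
  then have "(p @ q, p' @ q) \<in> word_equiv S R" "(p' @ q, p' @ q') \<in> word_equiv S R"
    using word_equiv_context[OF assms(1), of "[]" q] word_equiv_context[OF assms(2), of p' "[]"]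
    by auto
  then show ?thesis
    by (rule word_equiv_trans)
qed

lemma carrier_presented: "carrier (presented_group S R) = word_class ` words S"
  by (simp add: presented_group_def quotient_def UNION_singleton_eq_range)

lemma word_class_closed: "p \<in> words S \<Longrightarrow> word_class p \<in> carrier (presented_group S R)"
  unfolding carrier_presented by (rule imageI)

lemma presented_group_cases:
  assumes "x \<in> carrier (presented_group S R)"
  obtains p where "x = word_class p" "p \<in> words S"
  using assms unfolding carrier_presented by blast

lemma one_presented: "\<one>\<^bsub>presented_group S R\<^esub> = word_class []"
  by (simp add: presented_group_def)

lemma mult_presented:
  assumes "p \<in> words S" "q \<in> words S"
  shows "word_class p \<otimes>\<^bsub>presented_group S R\<^esub> word_class q = word_class (p @ q)"
proof -
  have "(\<Union>q'\<in>word_class q. word_class (p' @ q')) = word_class (p @ q)"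
    if "p' \<in> word_class p" for p'
  proof (intro UN_constant_eq ballI)
    show "q \<in> word_class q" using assms word_equiv_refl by simp
    fix q' assume "q' \<in> word_class q"
    with that have "(p @ q, p' @ q') \<in> word_equiv S R"
      by (simp add: word_equiv_append)
    then show "word_class (p' @ q') = word_class (p @ q)"
      by (rule equiv_class_eq[OF equiv_word_equiv, symmetric])
  qed
  then have "\<forall>p'\<in>word_class p. (\<Union>q'\<in>word_class q. word_class (p' @ q')) = word_class (p @ q)"
    by (rule ballI)
  moreover have "p \<in> word_class p" using assms word_equiv_refl by simp
  ultimately have "(\<Union>p'\<in>word_class p. \<Union>q'\<in>word_class q. word_class (p' @ q')) = word_class (p @ q)"
    by (rule UN_constant_eq[rotated])
  then show ?thesis
    by (simp add: presented_group_def)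
qed

definition inverse_word :: "'s word \<Rightarrow> 's word" where
  "inverse_word w = rev (map (\<lambda>(b, s). (\<not> b, s)) w)"

lemma inverse_word_words: "w \<in> words S \<Longrightarrow> inverse_word w \<in> words S"
  by (auto simp: inverse_word_def in_lists_conv_set)

text \<open>Reading \<open>inverse_word w @ w\<close> from the inside, the innermost two letters cancel; this is the
  reason why the monoid of words modulo the relations is a group.\<close>

lemma inverse_word_cancels:
  "w \<in> words S \<Longrightarrow> (inverse_word w @ w, []) \<in> word_equiv S R"
proof (induction w)
  case Nil
  then show ?case by (simp add: inverse_word_def word_equiv_refl)
next
  case (Cons l w)
  obtain b s where l: "l = (b, s)" by (cases l)
  have w: "w \<in> words S" "s \<in> S" using Cons.prems l by auto
  have "word_step S R (inverse_word w @ [(\<not> b, s), (\<not> \<not> b, s)] @ w) (inverse_word w @ w)"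
    using w inverse_word_words by (intro word_step.cancel) auto
  then have "(inverse_word (l # w) @ l # w, inverse_word w @ w) \<in> word_equiv S R"
    by (intro word_equiv_step) (simp add: l inverse_word_def)
  then show ?case
    using Cons.IH[OF w(1)] by (rule word_equiv_trans)
qed

lemma group_presented: "group (presented_group S R)" (is "group ?U")
proof (rule groupI)
  fix x y assume x: "x \<in> carrier (?U)" and y: "y \<in> carrier (?U)"
  obtain p where "x = word_class p" "p \<in> words S"
    using x by (rule presented_group_cases)
  moreover obtain q where "y = word_class q" "q \<in> words S"
    using y by (rule presented_group_cases)
  ultimately show "x \<otimes>\<^bsub>?U\<^esub> y \<in> carrier ?U"
    by (simp add: mult_presented word_class_closed)
next
  show "\<one>\<^bsub>?U\<^esub> \<in> carrier ?U"
    by (simp add: word_class_closed one_presented)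
next
  fix x y z assume x: "x \<in> carrier ?U" and y: "y \<in> carrier ?U" and z: "z \<in> carrier ?U"
  obtain p where "x = word_class p" "p \<in> words S"
    using x by (rule presented_group_cases)
  moreover obtain q where "y = word_class q" "q \<in> words S"
    using y by (rule presented_group_cases)
  moreover obtain r where "z = word_class r" "r \<in> words S"
    using z by (rule presented_group_cases)
  ultimately show "x \<otimes>\<^bsub>?U\<^esub> y \<otimes>\<^bsub>?U\<^esub> z = x \<otimes>\<^bsub>?U\<^esub> (y \<otimes>\<^bsub>?U\<^esub> z)"
    by (simp add: mult_presented)
next
  fix x assume "x \<in> carrier ?U"
  then obtain p where x: "x = word_class p" and p: "p \<in> words S"
    by (rule presented_group_cases)
  then show "\<one>\<^bsub>?U\<^esub> \<otimes>\<^bsub>?U\<^esub> x = x"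
    by (simp add: mult_presented one_presented)
  have "word_class (inverse_word p) \<otimes>\<^bsub>?U\<^esub> x = \<one>\<^bsub>?U\<^esub>"
    unfolding x one_presented mult_presented[OF inverse_word_words[OF p] p]
    by (rule equiv_class_eq[OF equiv_word_equiv inverse_word_cancels[OF p]])
  then show "\<exists>y\<in>carrier ?U. y \<otimes>\<^bsub>?U\<^esub> x = \<one>\<^bsub>?U\<^esub>"
    using word_class_closed[OF inverse_word_words[OF p]] by blast
qed

text \<open>Evaluating a word at the tautological generators returns its own class. Consequently a
  homomorphism out of the presented group is determined by its values on generators, which is
  how the maps between completions below are compared.\<close>

lemma eval_word_classes:
  assumes "w \<in> words S"
  shows "eval_word (presented_group S R) (\<lambda>s. word_class [(True, s)]) w = word_class w"
  using assms
proof (induction w)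
  case Nil
  then show ?case by (simp add: one_presented)
next
  case (Cons l w)
  interpret group "presented_group S R" by (rule group_presented)
  obtain b s where l: "l = (b, s)" by (cases l)
  have w: "w \<in> words S" "s \<in> S" using Cons.hyps l by auto
  have "inv\<^bsub>presented_group S R\<^esub> word_class [(True, s)] = word_class [(False, s)]"
  proof (rule inv_equality)
    show "word_class [(False, s)] \<otimes>\<^bsub>presented_group S R\<^esub> word_class [(True, s)]
        = \<one>\<^bsub>presented_group S R\<^esub>"
      using equiv_class_eq[OF equiv_word_equiv inverse_word_cancels[of "[(True, s)]"]] w
      by (simp add: mult_presented one_presented inverse_word_def)
  qed (use w in \<open>simp_all add: word_class_closed\<close>)
  then show ?case
    using Cons.IH w by (simp add: l mult_presented)
qed

end

lemma (in group) eval_word_closed: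
  assumes "f \<in> S \<rightarrow> carrier G" "w \<in> words S"
  shows "eval_word G f w \<in> carrier G"
  using assms(2)
proof (induction w)
  case (Cons l w)
  then show ?case using assms(1) by (cases l) auto
qed simp

lemma (in group) eval_word_append:
  assumes "f \<in> S \<rightarrow> carrier G" "v \<in> words S" "w \<in> words S"
  shows "eval_word G f (v @ w) = eval_word G f v \<otimes> eval_word G f w"
  using assms(2)
proof (induction v)
  case Nil
  then show ?case using eval_word_closed[OF assms(1,3)] by simp
next
  case (Cons l v)
  have "v \<in> words S" using Cons.hyps by simp
  then show ?case
    using Cons assms(1) eval_word_closed[OF assms(1)] assms(3)
    by (cases l) (auto simp: m_assoc Pi_iff)
qed

lemma (in group) hom_eval_word:
  assumes H: "group H" and h: "h \<in> hom G H" and f: "f \<in> S \<rightarrow> carrier G" and "w \<in> words S"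
  shows "h (eval_word G f w) = eval_word H (\<lambda>s. h (f s)) w"
proof -
  note closed = eval_word_closed[OF f]
  interpret group_hom G H h
    using H h by (simp add: group_hom_def group_hom_axioms_def is_group)
  show ?thesis
    using assms(4)
  proof (induction w)
    case (Cons l w)
    moreover have "eval_word G f w \<in> carrier G"
      using closed[OF Cons.hyps(2)] .
    ultimately show ?case
      using f by (cases l) (auto simp: Pi_iff)
  qed simp
qed

lemma eval_word_cong:
  assumes "\<And>s. s \<in> S \<Longrightarrow> f s = g s" "w \<in> words S"
  shows "eval_word H f w = eval_word H g w"
  using assms(2)
proof (induction w)
  case (Cons l w)
  then show ?case using assms(1) by (cases l) auto
qed simp

text \<open>The universal property of a presentation (von Dyck): an assignment of group elements to the
  generators under which all relations hold induces a homomorphism, evaluation of words.\<close>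

locale presentation_assignment = presentation S R + group H
  for S :: "'s set" and R :: "'s word rel" and H :: "('h, 'm) monoid_scheme" (structure) +
  fixes f :: "'s \<Rightarrow> 'h"
  assumes gens_closed: "f \<in> S \<rightarrow> carrier H"
    and rels_hold: "(r, r') \<in> R \<Longrightarrow> eval_word H f r = eval_word H f r'"
begin

lemma eval_word_step:
  assumes "word_step S R p q"
  shows "eval_word H f p = eval_word H f q"
  using assms
proof cases
  case (cancel u v s b)
  have s: "f s \<in> carrier H" using gens_closed cancel by auto
  have "[(b, s), (\<not> b, s)] \<in> words S" using cancel by simp
  moreover have "eval_word H f [(b, s), (\<not> b, s)] = \<one>" using s by simp
  ultimately show ?thesis
    using cancel by (simp add: eval_word_append[OF gens_closed] eval_word_closed[OF gens_closed]
        del: eval_word.simps Cons_in_lists_iff append_Cons)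
next
  case (relation u v r r')
  then have "r \<in> words S" "r' \<in> words S" using rels_words by auto
  then show ?thesis
    using relation rels_hold[of r r'] by (simp add: eval_word_append[OF gens_closed])
qed

lemma eval_word_equiv:
  assumes "(p, q) \<in> word_equiv S R"
  shows "eval_word H f p = eval_word H f q"
proof -
  have "equivclp (word_step S R) p q" using assms by (simp add: word_equiv_def)
  then show ?thesis
    by (induction rule: equivclp_induct) (metis eval_word_step)+
qed

lemma the_elem_eval_word_class:
  assumes "p \<in> words S"
  shows "the_elem (eval_word H f ` word_class p) = eval_word H f p"
proof (rule the_elem_image_unique)
  show "word_class p \<noteq> {}"
    using word_equiv_refl[OF assms] by blast
  fix q assume "q \<in> word_class p"
  then show "eval_word H f q = eval_word H f p"
    using eval_word_equiv[of p q] by simp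
qed

lemma presented_hom: "(\<lambda>C. the_elem (eval_word H f ` C)) \<in> hom (presented_group S R) H"
proof (rule homI)
  fix x y assume x: "x \<in> carrier (presented_group S R)" and y: "y \<in> carrier (presented_group S R)"
  obtain p where "x = word_class p" "p \<in> words S"
    using x by (rule presented_group_cases)
  moreover obtain q where "y = word_class q" "q \<in> words S"
    using y by (rule presented_group_cases)
  ultimately show "the_elem (eval_word H f ` (x \<otimes>\<^bsub>presented_group S R\<^esub> y)) =
      the_elem (eval_word H f ` x) \<otimes> the_elem (eval_word H f ` y)"
    by (simp add: mult_presented the_elem_eval_word_class eval_word_append[OF gens_closed])
next
  fix x assume "x \<in> carrier (presented_group S R)"
  then obtain p where "x = word_class p" "p \<in> words S"
    by (rule presented_group_cases)
  then show "the_elem (eval_word H f ` x) \<in> carrier H"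
    by (simp add: the_elem_eval_word_class eval_word_closed[OF gens_closed])
qed

end


section \<open>Cocycles on simply connected pregeometries\<close>

lemma pregeometryD:
  assumes "pregeometry I \<Delta>"
  shows "(x, y) \<in> incid \<Delta> \<Longrightarrow> x \<in> elts \<Delta> \<and> y \<in> elts \<Delta>"
    and "x \<in> elts \<Delta> \<Longrightarrow> (x, x) \<in> incid \<Delta>"
    and "(x, y) \<in> incid \<Delta> \<Longrightarrow> (y, x) \<in> incid \<Delta>"
    and "(x, y) \<in> incid \<Delta> \<Longrightarrow> type_of \<Delta> x = type_of \<Delta> y \<Longrightarrow> x = y"
  using assms by (auto simp: pregeometry_def refl_on_def dest: symD)

lemma is_path_append:
  "is_path \<Delta> (p @ x # q) \<longleftrightarrow> is_path \<Delta> (p @ [x]) \<and> is_path \<Delta> (x # q)"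
  by (auto simp: is_path_def successively_append_iff)

lemma is_path_Cons: "is_path \<Delta> (x # y # p) \<longleftrightarrow> x \<in> elts \<Delta> \<and> (x, y) \<in> incid \<Delta> \<and> is_path \<Delta> (y # p)"
  by (auto simp: is_path_def)

lemma connecting_path:
  assumes "(x, y) \<in> (incid \<Delta>)\<^sup>*" "x \<in> elts \<Delta>" "y \<in> elts \<Delta>" "incid \<Delta> \<subseteq> elts \<Delta> \<times> elts \<Delta>"
  shows "\<exists>p. is_path \<Delta> p \<and> hd p = x \<and> last p = y"
  using assms(1,2)
proof (induction rule: converse_rtrancl_induct)
  case base
  then show ?case by (intro exI[of _ "[y]"]) (simp add: is_path_def)
next
  case (step x z)
  then obtain p where p: "is_path \<Delta> p" "hd p = z" "last p = y"
    using assms(4) by blast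
  then obtain q where "p = z # q" by (cases p) (auto simp: is_path_def)
  with p step show ?case by (intro exI[of _ "x # p"]) (simp add: is_path_Cons)
qed

text \<open>The holonomy of a path with respect to an edge labelling.\<close>

fun path_prod :: "('h, 'm) monoid_scheme \<Rightarrow> ('a \<Rightarrow> 'a \<Rightarrow> 'h) \<Rightarrow> 'a list \<Rightarrow> 'h" where
  "path_prod H t (x # y # p) = t x y \<otimes>\<^bsub>H\<^esub> path_prod H t (y # p)"
| "path_prod H t p = \<one>\<^bsub>H\<^esub>"

text \<open>A multiplicative labelling of the edges that is flat on triangles. Since \<open>x\<close>, \<open>y\<close>, \<open>z\<close> need not
  be distinct, the condition also says that loops have label one and that reversing an edge
  inverts its label.\<close>

locale incidence_cocycle = group H for H (structure) +
  fixes \<Delta> :: "('a, 'i) pregeom" and J :: "'i set" and t :: "'a \<Rightarrow> 'a \<Rightarrow> 'b"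
  assumes pregeom: "pregeometry J \<Delta>"
    and cocycle_closed: "(x, y) \<in> incid \<Delta> \<Longrightarrow> t x y \<in> carrier H"
    and cocycle_mult: "(x, y) \<in> incid \<Delta> \<Longrightarrow> (y, z) \<in> incid \<Delta> \<Longrightarrow> (x, z) \<in> incid \<Delta> \<Longrightarrow>
      t x y \<otimes> t y z = t x z"
begin

lemma path_prod_closed: "is_path \<Delta> p \<Longrightarrow> path_prod H t p \<in> carrier H"
  by (induction p rule: induct_list012) (auto simp: is_path_Cons cocycle_closed)

lemma path_prod_append:
  "is_path \<Delta> (p @ x # q) \<Longrightarrow>
    path_prod H t (p @ x # q) = path_prod H t (p @ [x]) \<otimes> path_prod H t (x # q)"
proof (induction p)
  case Nil
  then show ?case using path_prod_closed by simp
next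
  case (Cons a p)
  obtain b r where b: "p @ x # q = b # r" by (cases "p @ x # q") auto
  obtain r' where b': "p @ [x] = b # r'" using b by (cases p) auto
  have "(a, b) \<in> incid \<Delta>" and path: "is_path \<Delta> (p @ x # q)"
    using Cons.prems by (auto simp: b is_path_Cons)
  then have "t a b \<in> carrier H" "path_prod H t (p @ [x]) \<in> carrier H"
    "path_prod H t (x # q) \<in> carrier H"
    using cocycle_closed path_prod_closed by (simp_all add: is_path_append[of \<Delta> p x q])
  then show ?case
    using Cons.IH[OF path] by (simp add: b b' m_assoc)
qed

lemma cocycle_refl: "x \<in> elts \<Delta> \<Longrightarrow> t x x = \<one>"
  using cocycle_mult[of x x x] cocycle_closed[of x x] pregeometryD(2)[OF pregeom] by simp

text \<open>Cycles of length at most three have pairwise incident vertices, so that the cocycle condition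
  collapses their labels to a single one, that of a loop.\<close>

lemma short_cycle_prod:
  assumes c: "c \<in> cycles_at \<Delta> x" and len: "path_length c \<in> {1, 2, 3}"
  shows "path_prod H t c = \<one>"
proof -
  note sym = pregeometryD(3)[OF pregeom] and refl = pregeometryD(2)[OF pregeom]
  have c': "is_path \<Delta> c" "hd c = x" "last c = x" using c by (auto simp: cycles_at_def)
  from len consider "length c = 2" | "length c = 3" | "length c = 4"
    by (auto simp: path_length_def)
  then show ?thesis
  proof cases
    case 1
    then obtain a b where "c = [a, b]" by (auto simp: length_Suc_conv numeral_eq_Suc)
    with c' show ?thesis by (simp add: is_path_Cons cocycle_refl)
  next
    case 2
    then obtain a b d where "c = [a, b, d]" by (auto simp: length_Suc_conv numeral_eq_Suc)
    with c' show ?thesis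
      using cocycle_mult[of x b x] refl[of x] by (auto simp: is_path_Cons cocycle_refl cocycle_closed)
  next
    case 3
    then obtain a b d e where "c = [a, b, d, e]" by (auto simp: length_Suc_conv numeral_eq_Suc)
    with c' have inc: "(x, b) \<in> incid \<Delta>" "(b, d) \<in> incid \<Delta>" "(d, x) \<in> incid \<Delta>" "x \<in> elts \<Delta>"
      and c_eq: "c = [x, b, d, x]"
      by (auto simp: is_path_Cons)
    have "t b d \<otimes> t d x = t b x"
      using inc(2,3) sym[OF inc(1)] by (rule cocycle_mult)
    moreover have "t x b \<otimes> t b x = \<one>"
      using cocycle_mult[OF inc(1) sym[OF inc(1)] refl[OF inc(4)]] cocycle_refl[OF inc(4)] by simp
    ultimately show ?thesis
      using inc cocycle_closed by (simp add: c_eq)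
  qed
qed

text \<open>Holonomy is a homotopy invariant, because only cycles with trivial holonomy get inserted.\<close>

lemma path_prod_cycle_insertion:
  assumes "cycle_insertion \<Delta> p q"
  shows "path_prod H t p = path_prod H t q"
  using assms
proof cases
  case (1 u x v c)
  then have path: "is_path \<Delta> (u @ [x])" "is_path \<Delta> (x # v)"
    by (auto simp: is_path_append[of \<Delta> u x v])
  have c: "is_path \<Delta> c" "hd c = x" "last c = x" "c \<noteq> []"
    using 1 by (auto simp: cycles_at_def is_path_def)
  obtain c1 where c1: "c = x # c1" using c by (cases c) auto
  obtain c2 where c2: "c = c2 @ [x]" using c by (metis append_butlast_last_id)
  have cv: "is_path \<Delta> (c @ v)"
    using c path is_path_append[of \<Delta> c2 x v] by (simp add: c2)
  then have ucv: "is_path \<Delta> (u @ c @ v)"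
    using path is_path_append[of \<Delta> u x "c1 @ v"] by (simp add: c1)
  have "path_prod H t (u @ c @ v) = path_prod H t (u @ [x]) \<otimes> path_prod H t (c @ v)"
    using path_prod_append[of u x "c1 @ v"] ucv by (simp add: c1)
  also have "path_prod H t (c @ v) = path_prod H t c \<otimes> path_prod H t (x # v)"
    using path_prod_append[of c2 x v] cv by (simp add: c2)
  also have "path_prod H t c = \<one>"
    using short_cycle_prod 1 by blast
  also have "path_prod H t (u @ [x]) \<otimes> (\<one> \<otimes> path_prod H t (x # v)) = path_prod H t (u @ [x] @ v)"
    using path_prod_append[of u x v] path path_prod_closed is_path_append[of \<Delta> u x v] by simp
  finally show ?thesis using 1 by simp
qed

lemma cycle_prod:
  assumes sc: "simply_connected_pregeom \<Delta>" and x: "x \<in> elts \<Delta>" and c: "c \<in> cycles_at \<Delta> x"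
  shows "path_prod H t c = \<one>"
proof -
  have triv: "[x] \<in> cycles_at \<Delta> x" using x by (simp add: cycles_at_def is_path_def)
  have "carrier (fundamental_group \<Delta> x) = {\<one>\<^bsub>fundamental_group \<Delta> x\<^esub>}"
    using sc x by (simp add: simply_connected_pregeom_def trivial_group_def)
  then have "cycles_at \<Delta> x // homotopic_cycles \<Delta> x = {homotopic_cycles \<Delta> x `` {[x]}}"
    by (simp add: fundamental_group_def)
  then have "homotopic_cycles \<Delta> x `` {c} = homotopic_cycles \<Delta> x `` {[x]}"
    using quotientI[OF c, of "homotopic_cycles \<Delta> x"] by simp
  moreover have "(c, c) \<in> homotopic_cycles \<Delta> x"
    using c by (simp add: homotopic_cycles_def equivclp_refl)
  ultimately have "([x], c) \<in> homotopic_cycles \<Delta> x"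
    by blast
  then have "equivclp (cycle_insertion \<Delta>) [x] c" by (simp add: homotopic_cycles_def)
  then have "path_prod H t [x] = path_prod H t c"
  proof (induction rule: equivclp_induct)
    case (step p q)
    then show ?case using path_prod_cycle_insertion[of p q] path_prod_cycle_insertion[of q p] by auto
  qed simp
  then show ?thesis by simp
qed

text \<open>On a simply connected pregeometry holonomy depends on the end points of a path only, so that
  the holonomy from a base point is a potential for the cocycle. In other words, a flat bundle
  over a simply connected pregeometry is trivial.\<close>

theorem simply_connected_imp_coboundary:
  assumes sc: "simply_connected_pregeom \<Delta>"
  shows "\<exists>\<sigma>. (\<forall>x\<in>elts \<Delta>. \<sigma> x \<in> carrier H) \<and> (\<forall>(x, y)\<in>incid \<Delta>. \<sigma> x \<otimes> t x y = \<sigma> y)"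
proof (cases "elts \<Delta> = {}")
  case True
  then have "incid \<Delta> = {}" using pregeom by (simp add: pregeometry_def)
  with True show ?thesis by simp
next
  case False
  then obtain a where a: "a \<in> elts \<Delta>" by blast
  have inc: "incid \<Delta> \<subseteq> elts \<Delta> \<times> elts \<Delta>" using pregeom by (simp add: pregeometry_def)
  have conn: "(x, y) \<in> (incid \<Delta>)\<^sup>*" if "x \<in> elts \<Delta>" "y \<in> elts \<Delta>" for x y
    using sc that by (simp add: simply_connected_pregeom_def connected_pregeom_def)
  have "\<forall>x\<in>elts \<Delta>. \<exists>p. is_path \<Delta> p \<and> hd p = a \<and> last p = x"
    using connecting_path[OF conn _ _ inc] a by simp
  then obtain P where "\<forall>x\<in>elts \<Delta>. is_path \<Delta> (P x) \<and> hd (P x) = a \<and> last (P x) = x"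
    by (elim bchoice[THEN exE])
  then have P: "is_path \<Delta> (P x)" "hd (P x) = a" "last (P x) = x" if "x \<in> elts \<Delta>" for x
    using that by blast+
  have eq: "path_prod H t p = path_prod H t q"
    if p: "is_path \<Delta> p" "hd p = a" "last p = x" and q: "is_path \<Delta> q" "hd q = a" "last q = x" for p q x
  proof -
    have x: "x \<in> elts \<Delta>" using p by (auto simp: is_path_def)
    \<comment> \<open>Both paths are closed up by the same way back, and the two cycles have trivial holonomy.\<close>
    obtain r where r: "is_path \<Delta> r" "hd r = x" "last r = a"
      using connecting_path[OF conn _ _ inc, OF x a x a] by blast
    then obtain r' where r': "r = x # r'" by (cases r) (auto simp: is_path_def)
    have cycle: "path_prod H t s \<otimes> path_prod H t r = \<one>"
      if s: "is_path \<Delta> s" "hd s = a" "last s = x" for s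
    proof -
      have "s \<noteq> []" using s by (simp add: is_path_def)
      then obtain s' where s': "s = s' @ [x]" using s by (metis append_butlast_last_id)
      have path: "is_path \<Delta> (s' @ x # r')"
        using s r by (simp add: is_path_append[of \<Delta> s' x r'] s' r')
      moreover have "hd (s' @ x # r') = a" using s(2) unfolding s' by (cases s') auto
      moreover have "last (s' @ x # r') = a" using r unfolding r' by simp
      ultimately have "path_prod H t (s' @ x # r') = \<one>"
        using cycle_prod[OF sc a] by (simp add: cycles_at_def)
      then show ?thesis using path_prod_append[OF path] by (simp add: s' r')
    qed
    show ?thesis
      using cycle[OF p] cycle[OF q] path_prod_closed p(1) q(1) r(1)
        right_cancel[of "path_prod H t r" "path_prod H t p" "path_prod H t q"] by simp
  qed
  have "path_prod H t (P x) \<otimes> t x y = path_prod H t (P y)" if xy: "(x, y) \<in> incid \<Delta>" for x y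
  proof -
    have x: "x \<in> elts \<Delta>" and y: "y \<in> elts \<Delta>" using xy inc by auto
    have "P x \<noteq> []" using P[OF x] by (simp add: is_path_def)
    then obtain p where p: "P x = p @ [x]" using P[OF x] by (metis append_butlast_last_id)
    have path: "is_path \<Delta> (p @ x # [y])"
      using P[OF x] xy x y by (simp add: p is_path_append[of \<Delta> p x "[y]"] is_path_Cons) (simp add: is_path_def)
    moreover have "hd (p @ x # [y]) = a" using P(2)[OF x] unfolding p by (cases p) auto
    ultimately have "path_prod H t (p @ x # [y]) = path_prod H t (P y)"
      using eq[of "p @ x # [y]" y "P y"] P[OF y] by simp
    then show ?thesis
      using path_prod_append[OF path] cocycle_closed[OF xy] by (simp add: p)
  qed
  moreover have "path_prod H t (P x) \<in> carrier H" if "x \<in> elts \<Delta>" for x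
    using path_prod_closed P that by blast
  ultimately show ?thesis by (intro exI[of _ "\<lambda>x. path_prod H t (P x)"]) auto
qed

end


section \<open>Groups acting with a strict fundamental domain\<close>

text \<open>A set \<open>W\<close> of vertices that contains one vertex of every orbit, and such that every
  flag as a whole can be moved into \<open>W\<close> by one group element. The second requirement makes the
  orbit space, with its incidence, a copy of \<open>W\<close>.\<close>

locale strict_fundamental_domain = group G for G (structure) +
  fixes act :: "'b \<Rightarrow> 'a \<Rightarrow> 'a" and \<Delta> :: "('a, 'i) pregeom" and J :: "'i set" and W :: "'a set"
  assumes pregeom: "pregeometry J \<Delta>"
    and act_one: "x \<in> elts \<Delta> \<Longrightarrow> act \<one> x = x"
    and act_mult: "g \<in> carrier G \<Longrightarrow> h \<in> carrier G \<Longrightarrow> x \<in> elts \<Delta> \<Longrightarrow>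
      act (g \<otimes> h) x = act g (act h x)"
    and act_incid: "g \<in> carrier G \<Longrightarrow> (x, y) \<in> incid \<Delta> \<Longrightarrow> (act g x, act g y) \<in> incid \<Delta>"
    and domain_elts: "W \<subseteq> elts \<Delta>"
    and domain_unique: "g \<in> carrier G \<Longrightarrow> w \<in> W \<Longrightarrow> act g w \<in> W \<Longrightarrow> act g w = w"
    and domain_flags: "flag \<Delta> F \<Longrightarrow> \<exists>g\<in>carrier G. F \<subseteq> act g ` W"
begin

lemma domain_elt: "w \<in> W \<Longrightarrow> w \<in> elts \<Delta>"
  using domain_elts by (rule subsetD)

lemma act_elts: "g \<in> carrier G \<Longrightarrow> x \<in> elts \<Delta> \<Longrightarrow> act g x \<in> elts \<Delta>"
  using act_incid[of g x x] pregeometryD(1,2)[OF pregeom] by blast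

lemma act_inv:
  assumes "g \<in> carrier G" "x \<in> elts \<Delta>" "act g x = y"
  shows "act (inv g) y = x"
  using act_mult[of "inv g" g x] assms act_one by simp

definition rep :: "'a \<Rightarrow> 'a" where
  "rep y = (SOME w. w \<in> W \<and> (\<exists>g\<in>carrier G. act g w = y))"

lemma rep_unique:
  assumes "w \<in> W" "g \<in> carrier G" "act g w = y"
  shows "rep y = w"
proof -
  have "rep y \<in> W \<and> (\<exists>g\<in>carrier G. act g (rep y) = y)"
    unfolding rep_def by (rule someI[of _ w]) (use assms in blast)
  then obtain h where h: "rep y \<in> W" "h \<in> carrier G" "act h (rep y) = y" by blast
  have "act (inv h \<otimes> g) w = rep y"
    using assms h act_mult[of "inv h" g w] act_inv[of h "rep y" y] domain_elt by auto
  then show ?thesis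
    using domain_unique[of "inv h \<otimes> g" w] assms h by auto
qed

lemma rep_domain: "w \<in> W \<Longrightarrow> rep w = w"
  using rep_unique[of w \<one> w] act_one domain_elt by blast

text \<open>The group element \<open>g\<close> carries the copy of \<open>F\<close> in the fundamental domain to \<open>F\<close>.\<close>

definition lifts :: "'b \<Rightarrow> 'a set \<Rightarrow> bool" where
  "lifts g F \<longleftrightarrow> g \<in> carrier G \<and> (\<forall>y\<in>F. rep y \<in> W \<and> act g (rep y) = y)"

lemma flag_lifts:
  assumes "flag \<Delta> F"
  shows "\<exists>g. lifts g F"
proof -
  obtain g where g: "g \<in> carrier G" "F \<subseteq> act g ` W" using domain_flags[OF assms] by blast
  have "rep y \<in> W \<and> act g (rep y) = y" if y: "y \<in> F" for y
  proof -
    obtain w where w: "w \<in> W" "y = act g w" using g y by blast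
    then have "rep y = w" using rep_unique[of w g y] g by simp
    with w show ?thesis by simp
  qed
  then show ?thesis unfolding lifts_def using g by blast
qed

lemma edge_lifts:
  assumes "(x, y) \<in> incid \<Delta>"
  shows "\<exists>g. lifts g {x, y}"
  using assms pregeometryD[OF pregeom] by (intro flag_lifts) (simp add: flag_def)

lemma rep_in_domain: "y \<in> elts \<Delta> \<Longrightarrow> rep y \<in> W"
  using edge_lifts[of y y] pregeometryD(2)[OF pregeom] by (auto simp: lifts_def)

lemma rep_incid:
  assumes "(x, y) \<in> incid \<Delta>"
  shows "(rep x, rep y) \<in> incid \<Delta>"
proof -
  obtain g where g: "lifts g {x, y}" using edge_lifts[OF assms] by blast
  then have "act (inv g) x = rep x" "act (inv g) y = rep y"
    using act_inv[of g "rep x" x] act_inv[of g "rep y" y] domain_elt by (auto simp: lifts_def)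
  then show ?thesis using act_incid[of "inv g" x y] assms g by (simp add: lifts_def)
qed

lemma rep_act: "w \<in> W \<Longrightarrow> g \<in> carrier G \<Longrightarrow> rep (act g w) = w"
  using rep_unique by blast

lemma lifts_act: "w \<in> W \<Longrightarrow> g \<in> carrier G \<Longrightarrow> lifts g {act g w}"
  using rep_act by (simp add: lifts_def)

text \<open>Two lifts of a vertex differ by an element of the stabilizer of its representative. All
  constructions below make choices of lifts, and this is what measures the ambiguity.\<close>

lemma lifts_quotient_stabilizer:
  assumes "lifts g {y}" "lifts h {y}"
  shows "inv g \<otimes> h \<in> stabilizer G act (rep y)"
  using assms act_mult[of "inv g" h "rep y"] act_inv[of g "rep y" y] domain_elt
  by (auto simp: lifts_def stabilizer_def)

text \<open>Starting at \<open>w \<in> W\<close>, whose lifts stabilize \<open>w\<close>, one walks along edges: an edge has a common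
  lift of both ends, hence if all lifts of one end are in \<open>S\<close>, so are all lifts of the other
  end. Every \<open>g\<close> is a lift of the vertex \<open>g w\<close>.\<close>

theorem stabilizers_generate:
  assumes conn: "connected_pregeom \<Delta>" and ne: "elts \<Delta> \<noteq> {}"
    and S: "subgroup S G" and stab: "\<And>w. w \<in> W \<Longrightarrow> stabilizer G act w \<subseteq> S"
  shows "carrier G \<subseteq> S"
proof
  fix g assume g: "g \<in> carrier G"
  obtain w where w: "w \<in> W" using ne rep_in_domain by blast
  let ?good = "\<lambda>y. \<forall>h. lifts h {y} \<longrightarrow> h \<in> S"
  have good: "?good y" if "(w, y) \<in> (incid \<Delta>)\<^sup>*" for y
    using that
  proof (induction rule: rtrancl_induct)
    case base
    then show ?case
      using stab[OF w] rep_domain[OF w] by (auto simp: lifts_def stabilizer_def)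
  next
    case (step y z)
    obtain h where h: "lifts h {y, z}" using edge_lifts[OF step(2)] by blast
    then have hS: "h \<in> S" "h \<in> carrier G" using step(3) by (auto simp: lifts_def)
    have zW: "rep z \<in> W" using h by (simp add: lifts_def)
    show ?case
    proof (intro allI impI)
      fix k assume k: "lifts k {z}"
      have "inv h \<otimes> k \<in> S"
        using lifts_quotient_stabilizer[of h z k] h k stab[OF zW] by (auto simp: lifts_def)
      then have "h \<otimes> (inv h \<otimes> k) \<in> S" using hS subgroup.m_closed[OF S] by blast
      then show "k \<in> S" using hS k by (simp add: lifts_def m_assoc[symmetric])
    qed
  qed
  have "(w, act g w) \<in> (incid \<Delta>)\<^sup>*"
    using conn w g act_elts domain_elt by (auto simp: connected_pregeom_def)
  then show "g \<in> S" using good lifts_act[OF w g] by blast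
qed

end

text \<open>The data of a morphism from the amalgam of vertex stabilizers to \<open>H\<close>. It defines a principal
  \<open>H\<close>-bundle over the pregeometry: the fibre over \<open>y\<close> consists of the pairs of a lift \<open>g\<close> of \<open>y\<close>
  and an element of \<open>H\<close>, modulo the stabilizer of \<open>rep y\<close>, which acts on \<open>H\<close> through \<open>f\<close>. A
  common lift of two incident vertices identifies their fibres, and by compatibility it does
  not matter which lift is taken.\<close>

locale compatible_stabilizer_homs = strict_fundamental_domain G act \<Delta> J W + H: group H
  for G :: "'b monoid" (structure) and act :: "'b \<Rightarrow> 'a \<Rightarrow> 'a" and \<Delta> :: "('a, 'i) pregeom"
    and J W and H :: "('h, 'm) monoid_scheme" +
  fixes f :: "'a \<Rightarrow> 'b \<Rightarrow> 'h"
  assumes stab_hom: "w \<in> W \<Longrightarrow> f w \<in> hom (G\<lparr>carrier := stabilizer G act w\<rparr>) H"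
    and stab_compat: "w \<in> W \<Longrightarrow> w' \<in> W \<Longrightarrow> (w, w') \<in> incid \<Delta> \<Longrightarrow>
      a \<in> stabilizer G act w \<Longrightarrow> a \<in> stabilizer G act w' \<Longrightarrow> f w a = f w' a"
begin

lemma f_closed: "w \<in> W \<Longrightarrow> a \<in> stabilizer G act w \<Longrightarrow> f w a \<in> carrier H"
  using stab_hom by (fastforce simp: hom_def)

lemma f_mult:
  "w \<in> W \<Longrightarrow> a \<in> stabilizer G act w \<Longrightarrow> b \<in> stabilizer G act w \<Longrightarrow>
    f w (a \<otimes> b) = f w a \<otimes>\<^bsub>H\<^esub> f w b"
  using stab_hom by (fastforce simp: hom_def)

definition base_lift :: "'a \<Rightarrow> 'b" where
  "base_lift y = (SOME g. lifts g {y})"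

lemma base_lift: "y \<in> elts \<Delta> \<Longrightarrow> lifts (base_lift y) {y}"
  unfolding base_lift_def using edge_lifts[of y y] pregeometryD(2)[OF pregeom]
  by (auto intro: someI_ex)

text \<open>The coordinate, in the trivialization of the fibre over \<open>y\<close> by \<open>base_lift y\<close>, of the point that
  the lift \<open>g\<close> defines.\<close>

definition coord :: "'a \<Rightarrow> 'b \<Rightarrow> 'h" where
  "coord y g = f (rep y) (inv (base_lift y) \<otimes> g)"

lemma coord_closed: "y \<in> elts \<Delta> \<Longrightarrow> lifts g {y} \<Longrightarrow> coord y g \<in> carrier H"
  unfolding coord_def
  using f_closed[OF rep_in_domain lifts_quotient_stabilizer] base_lift by blast

lemma coord_mult:
  assumes y: "y \<in> elts \<Delta>" and g: "lifts g {y}" and a: "a \<in> stabilizer G act (rep y)"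
  shows "coord y (g \<otimes> a) = coord y g \<otimes>\<^bsub>H\<^esub> f (rep y) a"
proof -
  have "g \<in> carrier G" "base_lift y \<in> carrier G" "a \<in> carrier G"
    using g a base_lift[OF y] by (auto simp: lifts_def stabilizer_def)
  then have "inv (base_lift y) \<otimes> (g \<otimes> a) = (inv (base_lift y) \<otimes> g) \<otimes> a"
    by (simp add: m_assoc)
  then show ?thesis
    unfolding coord_def
    using f_mult[OF rep_in_domain[OF y] lifts_quotient_stabilizer[OF base_lift[OF y] g] a] by simp
qed

definition transition :: "'a \<Rightarrow> 'a \<Rightarrow> 'h" where
  "transition x y = (let g = SOME g. lifts g {x, y} in coord x g \<otimes>\<^bsub>H\<^esub> inv\<^bsub>H\<^esub> coord y g)"

text \<open>Changing the common lift by \<open>a\<close> multiplies both coordinates on the right by the same element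
  \<open>f (rep x) a = f (rep y) a\<close>, which cancels.\<close>

lemma transition_eq:
  assumes xy: "(x, y) \<in> incid \<Delta>" and h: "lifts h {x, y}"
  shows "transition x y = coord x h \<otimes>\<^bsub>H\<^esub> inv\<^bsub>H\<^esub> coord y h"
proof -
  define g where "g = (SOME g. lifts g {x, y})"
  have g: "lifts g {x, y}" unfolding g_def using edge_lifts[OF xy] by (rule someI_ex)
  have el: "x \<in> elts \<Delta>" "y \<in> elts \<Delta>" using pregeometryD(1)[OF pregeom xy] by auto
  have lx: "lifts g {x}" "lifts h {x}" and ly: "lifts g {y}" "lifts h {y}"
    using g h by (auto simp: lifts_def)
  define a where "a = inv g \<otimes> h"
  have a: "a \<in> stabilizer G act (rep x)" "a \<in> stabilizer G act (rep y)"
    unfolding a_def using lifts_quotient_stabilizer lx ly by auto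
  have fa: "f (rep x) a = f (rep y) a"
    using stab_compat[OF rep_in_domain[OF el(1)] rep_in_domain[OF el(2)] rep_incid[OF xy] a] .
  have "h = g \<otimes> a"
    unfolding a_def using g h by (simp add: lifts_def m_assoc[symmetric])
  then have "coord x h = coord x g \<otimes>\<^bsub>H\<^esub> f (rep y) a" "coord y h = coord y g \<otimes>\<^bsub>H\<^esub> f (rep y) a"
    using coord_mult[OF el(1) lx(1) a(1)] coord_mult[OF el(2) ly(1) a(2)] fa by simp_all
  moreover have "coord x g \<in> carrier H" "coord y g \<in> carrier H" "f (rep y) a \<in> carrier H"
    using coord_closed[OF el(1) lx(1)] coord_closed[OF el(2) ly(1)]
      f_closed[OF rep_in_domain[OF el(2)] a(2)] by auto
  moreover have "(p \<otimes>\<^bsub>H\<^esub> r) \<otimes>\<^bsub>H\<^esub> inv\<^bsub>H\<^esub> (q \<otimes>\<^bsub>H\<^esub> r) = p \<otimes>\<^bsub>H\<^esub> inv\<^bsub>H\<^esub> q"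
    if "p \<in> carrier H" "q \<in> carrier H" "r \<in> carrier H" for p q r
    using that by (simp add: H.inv_mult_group H.m_assoc) (simp add: H.m_assoc[symmetric])
  ultimately show ?thesis
    by (simp add: transition_def g_def[symmetric])
qed

text \<open>The bundle is flat on triangles because a triangle is a flag and so has a common lift, with
  which all three transitions can be computed.\<close>

lemma transition_cocycle: "incidence_cocycle H \<Delta> J transition"
proof (unfold_locales, fact pregeom)
  fix x y assume xy: "(x, y) \<in> incid \<Delta>"
  obtain g where g: "lifts g {x, y}" using edge_lifts[OF xy] by blast
  then show "transition x y \<in> carrier H"
    using transition_eq[OF xy g] coord_closed pregeometryD(1)[OF pregeom xy]
    by (simp add: lifts_def)
next
  fix x y z assume xy: "(x, y) \<in> incid \<Delta>" and yz: "(y, z) \<in> incid \<Delta>" and xz: "(x, z) \<in> incid \<Delta>"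
  have "flag \<Delta> {x, y, z}"
    using xy yz xz pregeometryD[OF pregeom] by (simp add: flag_def)
  then obtain g where g: "lifts g {x, y, z}" using flag_lifts by blast
  then have l: "lifts g {x, y}" "lifts g {y, z}" "lifts g {x, z}" "lifts g {x}" "lifts g {y}" "lifts g {z}"
    by (auto simp: lifts_def)
  have c: "coord x g \<in> carrier H" "coord y g \<in> carrier H" "coord z g \<in> carrier H"
    using coord_closed l pregeometryD(1)[OF pregeom xy] pregeometryD(1)[OF pregeom yz] by auto
  have "inv\<^bsub>H\<^esub> coord y g \<otimes>\<^bsub>H\<^esub> (coord y g \<otimes>\<^bsub>H\<^esub> inv\<^bsub>H\<^esub> coord z g) = inv\<^bsub>H\<^esub> coord z g"
    using c by (simp add: H.m_assoc[symmetric])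
  then show "transition x y \<otimes>\<^bsub>H\<^esub> transition y z = transition x z"
    using c by (simp add: transition_eq[OF xy l(1)] transition_eq[OF yz l(2)] transition_eq[OF xz l(3)] H.m_assoc)
qed

text \<open>A global section of the bundle, viewed as a function \<open>s w g\<close> on the pairs of a vertex \<open>w\<close> of the
  domain and a group element \<open>g\<close>, that is, on a vertex \<open>g w\<close> together with a lift of it.\<close>

lemma flat_section:
  assumes sc: "simply_connected_pregeom \<Delta>"
  obtains s where "\<And>w g. w \<in> W \<Longrightarrow> g \<in> carrier G \<Longrightarrow> s w g \<in> carrier H"
    and "\<And>w g a. w \<in> W \<Longrightarrow> g \<in> carrier G \<Longrightarrow> a \<in> stabilizer G act w \<Longrightarrow>
      s w (g \<otimes> a) = s w g \<otimes>\<^bsub>H\<^esub> f w a"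
    and "\<And>w w' g. w \<in> W \<Longrightarrow> w' \<in> W \<Longrightarrow> (w, w') \<in> incid \<Delta> \<Longrightarrow> g \<in> carrier G \<Longrightarrow> s w g = s w' g"
proof -
  interpret incidence_cocycle H \<Delta> J transition by (rule transition_cocycle)
  obtain \<sigma> where \<sigma>: "\<forall>x\<in>elts \<Delta>. \<sigma> x \<in> carrier H"
    and edge: "\<forall>(x, y)\<in>incid \<Delta>. \<sigma> x \<otimes>\<^bsub>H\<^esub> transition x y = \<sigma> y"
    using simply_connected_imp_coboundary[OF sc] by blast
  define s where "s w g = \<sigma> (act g w) \<otimes>\<^bsub>H\<^esub> coord (act g w) g" for w g
  have el: "act g w \<in> elts \<Delta>" if "w \<in> W" "g \<in> carrier G" for g w
    using act_elts domain_elt that by blast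
  have cc: "coord (act g w) g \<in> carrier H" if "w \<in> W" "g \<in> carrier G" for g w
    using coord_closed[OF el[OF that] lifts_act[OF that]] .
  show thesis
  proof (rule that[of s])
    fix w g assume w: "w \<in> W" "g \<in> carrier G"
    then show "s w g \<in> carrier H" unfolding s_def using \<sigma> el cc by simp
  next
    fix w g a assume w: "w \<in> W" and g: "g \<in> carrier G" and a: "a \<in> stabilizer G act w"
    have aw: "act (g \<otimes> a) w = act g w" "a \<in> carrier G"
      using a g act_mult[of g a w] w domain_elt by (auto simp: stabilizer_def)
    have "coord (act g w) (g \<otimes> a) = coord (act g w) g \<otimes>\<^bsub>H\<^esub> f w a"
      using coord_mult[OF el[OF w g] lifts_act[OF w g]] a rep_act[OF w g] by simp
    then show "s w (g \<otimes> a) = s w g \<otimes>\<^bsub>H\<^esub> f w a"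
      unfolding s_def aw using \<sigma> el[OF w g] cc[OF w g] f_closed[OF w a] by (simp add: H.m_assoc)
  next
    fix w w' g assume w: "w \<in> W" "w' \<in> W" "(w, w') \<in> incid \<Delta>" and g: "g \<in> carrier G"
    have inc: "(act g w, act g w') \<in> incid \<Delta>" using act_incid[OF g w(3)] .
    have "lifts g {act g w, act g w'}" using w g rep_act by (simp add: lifts_def)
    then have tr: "transition (act g w) (act g w') = coord (act g w) g \<otimes>\<^bsub>H\<^esub> inv\<^bsub>H\<^esub> coord (act g w') g"
      by (rule transition_eq[OF inc])
    have "\<sigma> (act g w') = \<sigma> (act g w) \<otimes>\<^bsub>H\<^esub> transition (act g w) (act g w')"
      using edge inc by fastforce
    then show "s w g = s w' g"
      unfolding s_def tr using \<sigma> el[OF _ g] cc[OF _ g] w by (simp add: H.m_assoc)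
  qed
qed

text \<open>The group acts on flat sections by left translation, and since the pregeometry is connected,
  two flat sections differ by left multiplication with a constant of \<open>H\<close>. The constant that
  belongs to the translate of \<open>s\<close> by \<open>k\<close> depends on \<open>k\<close> multiplicatively; conjugated such that the
  section takes the value one at the identity, it is the required extension.\<close>

theorem simply_connected_extension:
  assumes sc: "simply_connected_pregeom \<Delta>"
  shows "\<exists>F\<in>hom G H. \<forall>w\<in>W. \<forall>a\<in>stabilizer G act w. F a = f w a"
proof (cases "elts \<Delta> = {}")
  case True
  then have "W = {}" using domain_elt by blast
  moreover have "(\<lambda>_. \<one>\<^bsub>H\<^esub>) \<in> hom G H" by (simp add: hom_def)
  ultimately show ?thesis by blast
next
  case False
  obtain s where s_closed: "\<And>w g. w \<in> W \<Longrightarrow> g \<in> carrier G \<Longrightarrow> s w g \<in> carrier H"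
    and s_stab: "\<And>w g a. w \<in> W \<Longrightarrow> g \<in> carrier G \<Longrightarrow> a \<in> stabilizer G act w \<Longrightarrow>
      s w (g \<otimes> a) = s w g \<otimes>\<^bsub>H\<^esub> f w a"
    and s_edge: "\<And>w w' g. w \<in> W \<Longrightarrow> w' \<in> W \<Longrightarrow> (w, w') \<in> incid \<Delta> \<Longrightarrow> g \<in> carrier G \<Longrightarrow> s w g = s w' g"
    using flat_section[OF sc] by blast
  obtain v where v: "v \<in> W" using False rep_in_domain by blast
  have conn: "(v, y) \<in> (incid \<Delta>)\<^sup>*" if "y \<in> elts \<Delta>" for y
    using sc that v domain_elt
    by (auto simp: simply_connected_pregeom_def connected_pregeom_def)
  note inc_elts = pregeometryD(1)[OF pregeom]
  define e where "e = s v \<one>"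
  have e: "e \<in> carrier H" unfolding e_def using s_closed v by simp
  \<comment> \<open>The value of the section at the identity is the same at all of \<open>W\<close>, since
    representatives of incident vertices are incident and thus \<open>W\<close> is connected.\<close>
  have s_one: "s w \<one> = e" if w: "w \<in> W" for w
  proof -
    have "s (rep y) \<one> = e" if "(v, y) \<in> (incid \<Delta>)\<^sup>*" for y
      using that
    proof (induction rule: rtrancl_induct)
      case base
      then show ?case by (simp add: rep_domain v e_def)
    next
      case (step y z)
      then have "s (rep y) \<one> = s (rep z) \<one>"
        using s_edge[OF rep_in_domain[of y] rep_in_domain[of z] rep_incid[of y z], of \<one>]
          inc_elts[OF step(2)] by simp
      with step show ?case by simp
    qed
    from this[OF conn[OF domain_elt[OF w]]] show ?thesis by (simp add: rep_domain[OF w])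
  qed
  define F where "F k = inv\<^bsub>H\<^esub> e \<otimes>\<^bsub>H\<^esub> s v k" for k
  have F_closed: "F k \<in> carrier H" if "k \<in> carrier G" for k
    unfolding F_def using s_closed[OF v that] e by simp
  \<comment> \<open>Translation by \<open>k\<close> multiplies the section by one constant of \<open>H\<close>, which is read off at
    \<open>v\<close> and the identity. The equation spreads from one lift of a vertex to all, and along edges.\<close>
  have translate: "s w (k \<otimes> g) = s v k \<otimes>\<^bsub>H\<^esub> (inv\<^bsub>H\<^esub> e \<otimes>\<^bsub>H\<^esub> s w g)"
    if k: "k \<in> carrier G" and wg: "w \<in> W" "g \<in> carrier G" for k w g
  proof -
    let ?ok = "\<lambda>y g. s (rep y) (k \<otimes> g) = s v k \<otimes>\<^bsub>H\<^esub> (inv\<^bsub>H\<^esub> e \<otimes>\<^bsub>H\<^esub> s (rep y) g)"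
    have stab_move: "?ok y (h \<otimes> a)"
      if y: "y \<in> elts \<Delta>" and h: "h \<in> carrier G" and ok: "?ok y h"
        and a: "a \<in> stabilizer G act (rep y)" for y h a
    proof -
      have W: "rep y \<in> W" and ac: "a \<in> carrier G"
        using rep_in_domain[OF y] a by (auto simp: stabilizer_def)
      have "s (rep y) (k \<otimes> (h \<otimes> a)) = s (rep y) (k \<otimes> h) \<otimes>\<^bsub>H\<^esub> f (rep y) a"
        using s_stab[OF W _ a, of "k \<otimes> h"] k h ac by (simp add: m_assoc)
      then show ?thesis
        using ok s_stab[OF W h a] s_closed[OF W h] s_closed[OF v k] e f_closed[OF W a]
        by (simp add: H.m_assoc)
    qed
    have all: "\<forall>g. lifts g {y} \<longrightarrow> ?ok y g" if "(v, y) \<in> (incid \<Delta>)\<^sup>*" for y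
      using that
    proof (induction rule: rtrancl_induct)
      case base
      have "?ok v \<one>"
        using s_closed[OF v k] e k by (simp add: rep_domain v e_def[symmetric])
      then have "?ok v (\<one> \<otimes> a)" if "a \<in> stabilizer G act (rep v)" for a
        using stab_move[OF domain_elt[OF v] one_closed _ that] by blast
      then show ?case
        by (auto simp: lifts_def stabilizer_def rep_domain v)
    next
      case (step y z)
      obtain h where h: "lifts h {y, z}" using edge_lifts[OF step(2)] by blast
      then have hc: "h \<in> carrier G" and hz: "lifts h {z}" and hy: "lifts h {y}"
        by (auto simp: lifts_def)
      have el: "y \<in> elts \<Delta>" "z \<in> elts \<Delta>" using inc_elts[OF step(2)] by auto
      have same: "s (rep y) g = s (rep z) g" if "g \<in> carrier G" for g
        using s_edge[OF rep_in_domain[OF el(1)] rep_in_domain[OF el(2)] rep_incid[OF step(2)] that] .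
      have "?ok y h" using step(3) hy by blast
      then have okz: "?ok z h" using same[of h] same[of "k \<otimes> h"] hc k by simp
      show ?case
      proof (intro allI impI)
        fix g assume g: "lifts g {z}"
        have "?ok z (h \<otimes> (inv h \<otimes> g))"
          using stab_move[OF el(2) hc okz lifts_quotient_stabilizer[OF hz g]] .
        moreover have "h \<otimes> (inv h \<otimes> g) = g"
          using hc g by (simp add: lifts_def m_assoc[symmetric])
        ultimately show "?ok z g" by simp
      qed
    qed
    have "act g w \<in> elts \<Delta>" using act_elts wg domain_elt by blast
    then have "?ok (act g w) g" using all[OF conn] lifts_act[OF wg] by blast
    then show ?thesis by (simp add: rep_act[OF wg])
  qed
  have "F \<in> hom G H"
  proof (rule homI)
    fix k l assume k: "k \<in> carrier G" and l: "l \<in> carrier G"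
    show "F (k \<otimes> l) = F k \<otimes>\<^bsub>H\<^esub> F l"
      unfolding F_def translate[OF k v l] using s_closed[OF v] k l e by (simp add: H.m_assoc)
  qed (rule F_closed)
  moreover have "F a = f w a" if w: "w \<in> W" and a: "a \<in> stabilizer G act w" for w a
  proof -
    have ac: "a \<in> carrier G" using a by (simp add: stabilizer_def)
    have "s w a = e \<otimes>\<^bsub>H\<^esub> f w a"
      using s_stab[OF w one_closed a] s_one[OF w] ac by simp
    moreover have "s w a = s v a"
      using translate[OF ac w one_closed] s_one[OF w] ac s_closed[OF v ac] e by simp
    ultimately show ?thesis
      unfolding F_def using e f_closed[OF w a] by (simp add: H.m_assoc[symmetric])
  qed
  ultimately show ?thesis by blast
qed

end


section \<open>Automorphism groups and stabilizers of flags\<close>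

lemma carrier_aut_group:
  "carrier (aut_group \<Gamma>) = {g \<in> Bij (elts \<Gamma>).
     (\<forall>x\<in>elts \<Gamma>. type_of \<Gamma> (g x) = type_of \<Gamma> x) \<and>
     (\<forall>x\<in>elts \<Gamma>. \<forall>y\<in>elts \<Gamma>. (g x, g y) \<in> incid \<Gamma> \<longleftrightarrow> (x, y) \<in> incid \<Gamma>)}"
  by (simp add: aut_group_def)

lemma aut_group_Bij: "g \<in> carrier (aut_group \<Gamma>) \<Longrightarrow> g \<in> Bij (elts \<Gamma>)"
  by (simp add: carrier_aut_group)

lemma aut_group_mult:
  assumes "g \<in> carrier (aut_group \<Gamma>)" "h \<in> carrier (aut_group \<Gamma>)" "x \<in> elts \<Gamma>"
  shows "(g \<otimes>\<^bsub>aut_group \<Gamma>\<^esub> h) x = g (h x)"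
  using assms by (simp add: aut_group_def BijGroup_def compose_def)

lemma aut_group_one: "x \<in> elts \<Gamma> \<Longrightarrow> \<one>\<^bsub>aut_group \<Gamma>\<^esub> x = x"
  by (simp add: aut_group_def BijGroup_def)

lemma group_aut_group: "group (aut_group \<Gamma>)"
proof -
  let ?B = "BijGroup (elts \<Gamma>)" and ?A = "carrier (aut_group \<Gamma>)"
  interpret group ?B by (rule group_BijGroup)
  have "subgroup ?A ?B"
  proof (rule subgroupI)
    show "?A \<subseteq> carrier ?B" by (auto simp: carrier_aut_group BijGroup_def)
    have "(\<lambda>x\<in>elts \<Gamma>. x) \<in> ?A" by (auto simp: carrier_aut_group id_Bij)
    then show "?A \<noteq> {}" by blast
  next
    fix g assume g: "g \<in> ?A"
    then have gB: "g \<in> Bij (elts \<Gamma>)" by (rule aut_group_Bij)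
    let ?h = "\<lambda>x\<in>elts \<Gamma>. inv_into (elts \<Gamma>) g x"
    have h: "?h x \<in> elts \<Gamma>" "g (?h x) = x" if "x \<in> elts \<Gamma>" for x
      using gB that by (auto simp: Bij_def bij_betw_def f_inv_into_f inv_into_into)
    have "type_of \<Gamma> (?h x) = type_of \<Gamma> x" if "x \<in> elts \<Gamma>" for x
    proof -
      have "type_of \<Gamma> (g (?h x)) = type_of \<Gamma> (?h x)"
        using g h(1)[OF that] unfolding carrier_aut_group by blast
      then show ?thesis unfolding h(2)[OF that] by (rule sym)
    qed
    moreover have "(?h x, ?h y) \<in> incid \<Gamma> \<longleftrightarrow> (x, y) \<in> incid \<Gamma>"
      if "x \<in> elts \<Gamma>" "y \<in> elts \<Gamma>" for x y
    proof -
      have "(g (?h x), g (?h y)) \<in> incid \<Gamma> \<longleftrightarrow> (?h x, ?h y) \<in> incid \<Gamma>"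
        using g h(1)[OF that(1)] h(1)[OF that(2)] unfolding carrier_aut_group by blast
      then show ?thesis unfolding h(2)[OF that(1)] h(2)[OF that(2)] by (rule sym)
    qed
    moreover have "?h \<in> Bij (elts \<Gamma>)" using gB by (rule restrict_inv_into_Bij)
    ultimately have "?h \<in> ?A" unfolding carrier_aut_group by blast
    then show "inv\<^bsub>?B\<^esub> g \<in> ?A" using inv_BijGroup[OF gB] by simp
  next
    fix g h assume g: "g \<in> ?A" and h: "h \<in> ?A"
    then have gB: "g \<in> Bij (elts \<Gamma>)" and hB: "h \<in> Bij (elts \<Gamma>)" by (simp_all add: aut_group_Bij)
    have "h x \<in> elts \<Gamma>" if "x \<in> elts \<Gamma>" for x using Bij_imp_funcset[OF hB] that by blast
    then have "compose (elts \<Gamma>) g h \<in> ?A"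
      using g h compose_Bij[OF gB hB] by (simp add: carrier_aut_group compose_def)
    then show "g \<otimes>\<^bsub>?B\<^esub> h \<in> ?A" using gB hB by (simp add: BijGroup_def)
  qed
  then have "group (?B\<lparr>carrier := ?A\<rparr>)" by (rule subgroup_imp_group)
  then show ?thesis by (simp add: aut_group_def)
qed

lemma flag_subset: "flag \<Gamma> F \<Longrightarrow> F' \<subseteq> F \<Longrightarrow> flag \<Gamma> F'"
  by (auto simp: flag_def)

lemma elts_residue:
  "x \<in> elts (residue \<Gamma> F) \<longleftrightarrow>
     x \<in> elts \<Gamma> \<and> type_of \<Gamma> x \<notin> type_of \<Gamma> ` F \<and> flag \<Gamma> (insert x F)"
  by (auto simp: residue_def induced_pregeom_def)

lemma incid_residue:
  "(x, y) \<in> incid (residue \<Gamma> F) \<longleftrightarrow>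
     (x, y) \<in> incid \<Gamma> \<and> x \<in> elts (residue \<Gamma> F) \<and> y \<in> elts (residue \<Gamma> F)"
  by (auto simp: residue_def induced_pregeom_def)

lemma type_residue: "type_of (residue \<Gamma> F) = type_of \<Gamma>"
  by (simp add: residue_def induced_pregeom_def)

lemma pregeometry_residue:
  assumes "pregeometry I \<Gamma>"
  shows "pregeometry (type_of \<Gamma> ` elts (residue \<Gamma> F)) (residue \<Gamma> F)"
  using pregeometryD[OF assms] unfolding pregeometry_def refl_on_def sym_def type_residue
  by (auto simp: incid_residue elts_residue)

text \<open>The hypotheses on the geometry, with the orbit representatives replaced by what they
  provide: \<open>W\<close> meets every orbit exactly once.\<close>

locale hall_action =
  fixes I :: "'i set" and \<Gamma> :: "('a, 'i) pregeom" and G :: "('a \<Rightarrow> 'a) set" and W :: "'a set"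
  assumes finite_types: "finite I"
    and geom: "geometry I \<Gamma>"
    and subgroup_aut: "subgroup G (aut_group \<Gamma>)"
    and hall: "hall I \<Gamma> W"
    and orbit_meets: "x \<in> elts \<Gamma> \<Longrightarrow> \<exists>w\<in>W. \<exists>g\<in>G. g w = x"
    and orbit_unique: "g \<in> G \<Longrightarrow> w \<in> W \<Longrightarrow> g w \<in> W \<Longrightarrow> g w = w"
    and orbits_transitive: "V \<subseteq> W \<Longrightarrow> flag \<Gamma> V \<Longrightarrow>
      flag_transitive_on G (induced_pregeom \<Gamma> (\<Union>x\<in>V. aut_orbit \<Gamma> G x))"
begin

lemma pregeom: "pregeometry I \<Gamma>"
  using geom by (simp add: geometry_def)

lemma domain_elt: "w \<in> W \<Longrightarrow> w \<in> elts \<Gamma>"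
  using hall by (auto simp: hall_def)

lemma type_closed: "x \<in> elts \<Gamma> \<Longrightarrow> type_of \<Gamma> x \<in> I"
  using pregeom by (auto simp: pregeometry_def)

lemma flag_type_eq: "flag \<Gamma> F \<Longrightarrow> x \<in> F \<Longrightarrow> y \<in> F \<Longrightarrow> type_of \<Gamma> x = type_of \<Gamma> y \<Longrightarrow> x = y"
  using pregeometryD(4)[OF pregeom] by (simp add: flag_def)

lemma finite_flag:
  assumes "flag \<Gamma> F"
  shows "finite F"
proof (rule finite_imageD)
  show "finite (type_of \<Gamma> ` F)"
    using assms type_closed finite_types by (auto simp: flag_def intro: finite_subset)
  show "inj_on (type_of \<Gamma>) F"
    using flag_type_eq[OF assms] by (auto intro: inj_onI)
qed

lemma aut_in: "g \<in> G \<Longrightarrow> g \<in> carrier (aut_group \<Gamma>)"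
  using subgroup.subset[OF subgroup_aut] by blast

lemma aut_elt: "g \<in> G \<Longrightarrow> x \<in> elts \<Gamma> \<Longrightarrow> g x \<in> elts \<Gamma>"
  using Bij_imp_funcset[OF aut_group_Bij[OF aut_in]] by blast

lemma aut_type: "g \<in> G \<Longrightarrow> x \<in> elts \<Gamma> \<Longrightarrow> type_of \<Gamma> (g x) = type_of \<Gamma> x"
  using aut_in unfolding carrier_aut_group by blast

lemma aut_incid: "g \<in> G \<Longrightarrow> (x, y) \<in> incid \<Gamma> \<Longrightarrow> (g x, g y) \<in> incid \<Gamma>"
  using aut_in pregeometryD(1)[OF pregeom, of x y] unfolding carrier_aut_group by blast

lemma group_subaut: "group (subaut \<Gamma> G)"
  using group.subgroup_imp_group[OF group_aut_group subgroup_aut] .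

lemma one_in: "\<one>\<^bsub>aut_group \<Gamma>\<^esub> \<in> G"
  using subgroup.one_closed[OF subgroup_aut] .

lemma subgroup_flag_stabilizer:
  assumes "U \<subseteq> elts \<Gamma>"
  shows "subgroup (flag_stabilizer G U) (subaut \<Gamma> G)"
proof -
  interpret group "subaut \<Gamma> G" by (rule group_subaut)
  show ?thesis
  proof (rule subgroupI)
    show "flag_stabilizer G U \<subseteq> carrier (subaut \<Gamma> G)" by (auto simp: flag_stabilizer_def)
    have "\<one>\<^bsub>aut_group \<Gamma>\<^esub> \<in> flag_stabilizer G U"
      using one_in aut_group_one[OF subsetD[OF assms]] by (simp add: flag_stabilizer_def)
    then show "flag_stabilizer G U \<noteq> {}" by blast
  next
    fix g assume g: "g \<in> flag_stabilizer G U"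
    then have gG: "g \<in> G" by (simp add: flag_stabilizer_def)
    let ?h = "inv\<^bsub>subaut \<Gamma> G\<^esub> g"
    have hG: "?h \<in> G" using inv_closed[of g] gG by simp
    have hg: "?h \<otimes>\<^bsub>aut_group \<Gamma>\<^esub> g = \<one>\<^bsub>aut_group \<Gamma>\<^esub>" using l_inv[of g] gG by simp
    have "?h x = x" if "x \<in> U" for x
    proof -
      have "x \<in> elts \<Gamma>" "g x = x" using that assms g by (auto simp: flag_stabilizer_def)
      then show ?thesis
        using aut_group_mult[OF aut_in[OF hG] aut_in[OF gG], of x] aut_group_one[of x \<Gamma>]
        unfolding hg by simp
    qed
    with hG show "?h \<in> flag_stabilizer G U" by (simp add: flag_stabilizer_def)
  next
    fix g h assume "g \<in> flag_stabilizer G U" "h \<in> flag_stabilizer G U"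
    then show "g \<otimes>\<^bsub>subaut \<Gamma> G\<^esub> h \<in> flag_stabilizer G U"
      using aut_group_mult[OF aut_in aut_in] subgroup.m_closed[OF subgroup_aut] assms
      by (auto simp: flag_stabilizer_def subset_iff)
  qed
qed

lemma group_flag_stabilizer:
  assumes "U \<subseteq> elts \<Gamma>"
  shows "group (subaut \<Gamma> (flag_stabilizer G U))"
  using group.subgroup_imp_group[OF group_subaut subgroup_flag_stabilizer[OF assms]] by simp

lemma flag_stabilizer_empty: "flag_stabilizer G {} = G"
  by (simp add: flag_stabilizer_def)

lemma flag_stabilizer_mono: "U \<subseteq> U' \<Longrightarrow> flag_stabilizer G U' \<subseteq> flag_stabilizer G U"
  by (auto simp: flag_stabilizer_def)

text \<open>The representatives of the elements of a flag have distinct types, hence they form a flag by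
  the hall property. It lies in the same orbits and has the same type as the given flag, so
  flag-transitivity on these orbits provides the conjugating element.\<close>

lemma flag_conjugate_into_domain:
  assumes F: "flag \<Gamma> F"
  shows "\<exists>g\<in>G. \<exists>V\<subseteq>W. flag \<Gamma> V \<and> g ` V = F"
proof -
  have Fel: "F \<subseteq> elts \<Gamma>" using F by (simp add: flag_def)
  have "\<forall>x\<in>F. \<exists>w. w \<in> W \<and> (\<exists>g\<in>G. g w = x)" using orbit_meets Fel by blast
  then obtain \<rho> where \<rho>: "\<forall>x\<in>F. \<rho> x \<in> W \<and> (\<exists>g\<in>G. g (\<rho> x) = x)"
    by (elim bchoice[THEN exE])
  define V where "V = \<rho> ` F"
  have VW: "V \<subseteq> W" using \<rho> by (auto simp: V_def)
  have ty: "type_of \<Gamma> (\<rho> x) = type_of \<Gamma> x" if x: "x \<in> F" for x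
  proof -
    obtain g where "g \<in> G" "g (\<rho> x) = x" "\<rho> x \<in> W" using \<rho> x by blast
    then show ?thesis using aut_type[of g "\<rho> x"] domain_elt by simp
  qed
  have "inj_on (type_of \<Gamma>) V"
  proof (rule inj_onI)
    fix a b assume "a \<in> V" "b \<in> V" and t: "type_of \<Gamma> a = type_of \<Gamma> b"
    then obtain x y where "x \<in> F" "a = \<rho> x" "y \<in> F" "b = \<rho> y" unfolding V_def by blast
    moreover from this have "x = y" using ty t flag_type_eq[OF F] by simp
    ultimately show "a = b" by simp
  qed
  then have V: "flag \<Gamma> V" using hall VW by (simp add: hall_def)
  let ?O = "\<Union>x\<in>V. aut_orbit \<Gamma> G x"
  have "F \<subseteq> ?O"
  proof
    fix x assume x: "x \<in> F"
    then obtain g where "g \<in> G" "g (\<rho> x) = x" using \<rho> by blast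
    then have "x \<in> aut_orbit \<Gamma> G (\<rho> x)"
      unfolding orbit_def by (intro CollectI exI[of _ g]) simp
    then show "x \<in> ?O" using x unfolding V_def by blast
  qed
  moreover have "V \<subseteq> ?O"
  proof
    fix v assume v: "v \<in> V"
    have "\<one>\<^bsub>aut_group \<Gamma>\<^esub> v = v"
      by (rule aut_group_one[OF domain_elt[OF subsetD[OF VW v]]])
    then have "v \<in> aut_orbit \<Gamma> G v"
      unfolding orbit_def using one_in by (intro CollectI exI[of _ "\<one>\<^bsub>aut_group \<Gamma>\<^esub>"]) simp
    then show "v \<in> ?O" using v by blast
  qed
  ultimately have "flag (induced_pregeom \<Gamma> ?O) F" "flag (induced_pregeom \<Gamma> ?O) V"
    using F V by (auto simp: flag_def induced_pregeom_def)
  moreover have "type_of \<Gamma> ` V = type_of \<Gamma> ` F"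
    using ty unfolding V_def image_image by (rule image_cong[OF refl])
  then have "type_of (induced_pregeom \<Gamma> ?O) ` V = type_of (induced_pregeom \<Gamma> ?O) ` F"
    by (simp add: induced_pregeom_def)
  ultimately obtain g where "g \<in> G" "g ` V = F"
    using orbits_transitive[OF VW V] unfolding flag_transitive_on_def by blast
  with VW V show ?thesis by blast
qed

lemma flag_residue_union:
  assumes U: "flag \<Gamma> U" and F: "flag (residue \<Gamma> U) F"
  shows "flag \<Gamma> (U \<union> F)"
proof -
  have "(x, y) \<in> incid \<Gamma>" if "x \<in> U \<union> F" "y \<in> U \<union> F" for x y
  proof -
    have "flag \<Gamma> (insert y U)" if "y \<in> F" for y using F that by (auto simp: flag_def[of "residue \<Gamma> U"] elts_residue)
    moreover have "(x, y) \<in> incid \<Gamma>" if "x \<in> F" "y \<in> F" for x y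
      using F that by (auto simp: flag_def[of "residue \<Gamma> U"] incid_residue)
    ultimately show ?thesis using that U by (auto simp: flag_def)
  qed
  moreover have "U \<union> F \<subseteq> elts \<Gamma>"
    using U F by (auto simp: flag_def elts_residue)
  ultimately show ?thesis by (simp add: flag_def)
qed

lemma stabilizer_in_residue:
  "stabilizer (subaut \<Gamma> (flag_stabilizer G U)) (\<lambda>g. g) w = flag_stabilizer G (insert w U)"
  by (auto simp: stabilizer_def flag_stabilizer_def)

text \<open>The situation is inherited by residues. A flag of the residue together with \<open>U\<close> is a flag of
  the geometry; an element of \<open>G\<close> moving a flag of \<open>W\<close> onto it fixes \<open>U\<close> elementwise, because
  each element of \<open>U\<close> is the only one of its orbit in \<open>W\<close>.\<close>

lemma residue_domain:
  assumes UW: "U \<subseteq> W" and U: "flag \<Gamma> U"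
  shows "strict_fundamental_domain (subaut \<Gamma> (flag_stabilizer G U)) (\<lambda>g. g) (residue \<Gamma> U)
    (type_of \<Gamma> ` elts (residue \<Gamma> U)) (W \<inter> elts (residue \<Gamma> U))"
proof -
  have Uel: "U \<subseteq> elts \<Gamma>" using U by (simp add: flag_def)
  interpret K: group "subaut \<Gamma> (flag_stabilizer G U)" by (rule group_flag_stabilizer[OF Uel])
  show ?thesis
  proof (unfold_locales, rule pregeometry_residue[OF pregeom])
    fix x assume "x \<in> elts (residue \<Gamma> U)"
    then show "\<one>\<^bsub>subaut \<Gamma> (flag_stabilizer G U)\<^esub> x = x"
      by (simp add: elts_residue aut_group_one)
  next
    fix g h x
    assume "g \<in> carrier (subaut \<Gamma> (flag_stabilizer G U))"
      "h \<in> carrier (subaut \<Gamma> (flag_stabilizer G U))" "x \<in> elts (residue \<Gamma> U)"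
    then show "(g \<otimes>\<^bsub>subaut \<Gamma> (flag_stabilizer G U)\<^esub> h) x = g (h x)"
      by (simp add: elts_residue flag_stabilizer_def aut_in aut_group_mult)
  next
    fix g x y assume "g \<in> carrier (subaut \<Gamma> (flag_stabilizer G U))"
      and xy: "(x, y) \<in> incid (residue \<Gamma> U)"
    then have g: "g \<in> G" and gU: "\<forall>u\<in>U. g u = u" by (auto simp: flag_stabilizer_def)
    have "g z \<in> elts (residue \<Gamma> U)" if z: "z \<in> elts (residue \<Gamma> U)" for z
    proof -
      have z': "z \<in> elts \<Gamma>" "type_of \<Gamma> z \<notin> type_of \<Gamma> ` U" "flag \<Gamma> (insert z U)"
        using z by (auto simp: elts_residue)
      have "(g a, g b) \<in> incid \<Gamma>" if "a \<in> insert z U" "b \<in> insert z U" for a b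
        using aut_incid[OF g, of a b] z'(3) that unfolding flag_def by blast
      then have "flag \<Gamma> (g ` insert z U)"
        using aut_elt[OF g] z'(3) by (auto simp: flag_def)
      moreover have "g ` insert z U = insert (g z) U" using gU by force
      ultimately show ?thesis
        using z' aut_elt[OF g] aut_type[OF g] by (simp add: elts_residue)
    qed
    then show "(g x, g y) \<in> incid (residue \<Gamma> U)"
      using xy aut_incid[OF g] by (simp add: incid_residue)
  next
    fix g w assume "g \<in> carrier (subaut \<Gamma> (flag_stabilizer G U))"
      "w \<in> W \<inter> elts (residue \<Gamma> U)" "g w \<in> W \<inter> elts (residue \<Gamma> U)"
    then show "g w = w" using orbit_unique by (simp add: flag_stabilizer_def)
  next
    fix F assume F: "flag (residue \<Gamma> U) F"
    obtain g V where g: "g \<in> G" and V: "V \<subseteq> W" "flag \<Gamma> V" and gV: "g ` V = U \<union> F"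
      using flag_conjugate_into_domain[OF flag_residue_union[OF U F]] by blast
    have stab: "u \<in> V \<and> g u = u" if u: "u \<in> U" for u
    proof -
      obtain v where v: "v \<in> V" "u = g v" using gV u by blast
      then have "g v = v" using orbit_unique[OF g, of v] V(1) u UW by blast
      with v show ?thesis by simp
    qed
    then have "g \<in> flag_stabilizer G U" using g by (simp add: flag_stabilizer_def)
    moreover have "F \<subseteq> g ` (W \<inter> elts (residue \<Gamma> U))"
    proof
      fix y assume y: "y \<in> F"
      then obtain v where v: "v \<in> V" "y = g v" using gV by blast
      have vel: "v \<in> elts \<Gamma>" using v V domain_elt by blast
      have "type_of \<Gamma> v \<notin> type_of \<Gamma> ` U"
        using F y v aut_type[OF g vel] by (auto simp: flag_def elts_residue)
      moreover have "flag \<Gamma> (insert v U)"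
        using flag_subset[OF V(2)] stab v by blast
      ultimately have "v \<in> elts (residue \<Gamma> U)" using vel by (simp add: elts_residue)
      then show "y \<in> g ` (W \<inter> elts (residue \<Gamma> U))" using v V by blast
    qed
    ultimately show "\<exists>g\<in>carrier (subaut \<Gamma> (flag_stabilizer G U)).
        F \<subseteq> g ` (W \<inter> elts (residue \<Gamma> U))"
      by auto
  qed simp
qed

lemma flag_elt_residue:
  assumes C: "flag \<Gamma> C" and F: "F \<subseteq> C" and z: "z \<in> C" "z \<notin> F"
  shows "z \<in> elts (residue \<Gamma> F)"
proof -
  have "type_of \<Gamma> z \<notin> type_of \<Gamma> ` F"
  proof
    assume "type_of \<Gamma> z \<in> type_of \<Gamma> ` F"
    then obtain x where x: "x \<in> F" "type_of \<Gamma> z = type_of \<Gamma> x" by blast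
    then have "z = x" using flag_type_eq[OF C z(1)] F by blast
    with x z show False by simp
  qed
  moreover have "flag \<Gamma> (insert z F)" using flag_subset[OF C] F z by blast
  moreover have "z \<in> elts \<Gamma>" using C z by (auto simp: flag_def)
  ultimately show ?thesis by (simp add: elts_residue)
qed

text \<open>A chamber that contains \<open>U\<close> has its remaining elements in the residue of \<open>U\<close>.\<close>

lemma residue_empty_types:
  assumes U: "flag \<Gamma> U" and empty: "elts (residue \<Gamma> U) = {}"
  shows "type_of \<Gamma> ` U = I"
proof -
  obtain C where C: "chamber I \<Gamma> C" "U \<subseteq> C" using geom U by (auto simp: geometry_def)
  have "c \<in> U" if c: "c \<in> C" for c
  proof (rule ccontr)
    assume "c \<notin> U"
    then have "c \<in> elts (residue \<Gamma> U)"
      using flag_elt_residue[OF _ C(2) c] C(1) by (simp add: chamber_def)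
    with empty show False by simp
  qed
  then have "C = U" using C(2) by blast
  then show ?thesis using C(1) by (simp add: chamber_def)
qed

text \<open>By downward induction along the chamber \<open>C\<close>, the residue of each \<open>F \<subseteq> C\<close> lies in \<open>C\<close>: if
  \<open>F \<noteq> C\<close>, it contains an element of \<open>C\<close>, and an edge from \<open>a \<in> C\<close> to another vertex leads
  into the residue of \<open>insert a F\<close>. This settles the case of a chamber outside of the shape, whose
  stabilizer cannot be generated by stabilizers of larger flags.\<close>

lemma connected_residues_single_chamber:
  assumes C: "flag \<Gamma> C" "type_of \<Gamma> ` C = I"
    and conn: "\<And>F. F \<subseteq> C \<Longrightarrow> connected_pregeom (residue \<Gamma> F)"
  shows "elts \<Gamma> \<subseteq> C"
proof -
  have "elts (residue \<Gamma> F) \<subseteq> C" if "F \<subseteq> C" for F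
    using that
  proof (induction "card (C - F)" arbitrary: F rule: less_induct)
    case less
    have F: "flag \<Gamma> F" using flag_subset[OF C(1) less.prems] .
    show ?case
    proof (cases "C = F")
      case True
      then show ?thesis using C(2) type_closed by (auto simp: elts_residue)
    next
      case False
      then obtain z where z: "z \<in> C" "z \<notin> F" using less.prems by blast
      then have zr: "z \<in> elts (residue \<Gamma> F)"
        using flag_elt_residue[OF C(1) less.prems] by blast
      show ?thesis
      proof
        fix y assume "y \<in> elts (residue \<Gamma> F)"
        then have "(z, y) \<in> (incid (residue \<Gamma> F))\<^sup>*"
          using conn[OF less.prems] zr by (simp add: connected_pregeom_def)
        then show "y \<in> C"
        proof (induction rule: rtrancl_induct)
          case base
          then show ?case using z by simp
        next
          case (step a b)
          then have ab: "(a, b) \<in> incid \<Gamma>" "a \<in> elts (residue \<Gamma> F)" "b \<in> elts (residue \<Gamma> F)"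
            by (auto simp: incid_residue)
          show ?case
          proof (cases "a = b")
            case False
            then have "type_of \<Gamma> b \<noteq> type_of \<Gamma> a" using pregeometryD(4)[OF pregeom ab(1)] by auto
            moreover have "flag (residue \<Gamma> F) {a, b}"
              using step(2) ab pregeometryD(2,3)[OF pregeometry_residue[OF pregeom]]
              by (simp add: flag_def)
            then have "flag \<Gamma> (F \<union> {a, b})" by (rule flag_residue_union[OF F])
            moreover have "F \<union> {a, b} = insert b (insert a F)" by auto
            ultimately have "b \<in> elts (residue \<Gamma> (insert a F))"
              using ab(3) by (simp add: elts_residue)
            moreover have "a \<notin> F" using ab(2) by (auto simp: elts_residue)
            then have "card (C - insert a F) < card (C - F)"
              using step(3) finite_flag[OF C(1)] by (intro psubset_card_mono) auto
            then have "elts (residue \<Gamma> (insert a F)) \<subseteq> C"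
              using less.hyps step(3) less.prems by simp
            ultimately show ?thesis by blast
          qed (use step in simp)
        qed
      qed
    qed
  qed
  from this[of "{}"] show ?thesis
    using pregeometryD(2)[OF pregeom] by (auto simp: elts_residue flag_def)
qed

lemma single_chamber_trivial:
  assumes C: "flag \<Gamma> C" "elts \<Gamma> \<subseteq> C" and g: "g \<in> G"
  shows "g = \<one>\<^bsub>aut_group \<Gamma>\<^esub>"
proof (rule extensionalityI[of _ "elts \<Gamma>"])
  show "g \<in> extensional (elts \<Gamma>)" "\<one>\<^bsub>aut_group \<Gamma>\<^esub> \<in> extensional (elts \<Gamma>)"
    using aut_group_Bij aut_in g one_in by (auto intro!: Bij_imp_extensional)
  fix x assume x: "x \<in> elts \<Gamma>"
  then have "g x = x"
    using flag_type_eq[OF C(1), of "g x" x] C(2) aut_elt[OF g] aut_type[OF g] by blast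
  then show "g x = \<one>\<^bsub>aut_group \<Gamma>\<^esub> x" using aut_group_one[OF x] by simp
qed

end


section \<open>Generation and extension along a shape\<close>

lemma (in group) subgroup_equalizer:
  assumes "group H" "f \<in> hom G H" "h \<in> hom G H"
  shows "subgroup {a \<in> carrier G. f a = h a} G"
proof -
  interpret f: group_hom G H f using assms by (simp add: group_hom_def group_hom_axioms_def is_group)
  interpret h: group_hom G H h using assms by (simp add: group_hom_def group_hom_axioms_def is_group)
  show ?thesis
  proof (rule subgroupI)
    have "\<one> \<in> {a \<in> carrier G. f a = h a}" by simp
    then show "{a \<in> carrier G. f a = h a} \<noteq> {}" by blast
  qed auto
qed

lemma hom_restrict_carrier:
  assumes "f \<in> hom (K\<lparr>carrier := A\<rparr>) H" "B \<subseteq> A"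
  shows "f \<in> hom (K\<lparr>carrier := B\<rparr>) H"
  using assms by (auto simp: hom_def Pi_iff subset_iff)

locale hall_shape = hall_action I \<Gamma> G W
  for I :: "'i set" and \<Gamma> :: "('a, 'i) pregeom" and G W +
  fixes \<W> :: "'a set set"
  assumes shape: "shape \<Gamma> W \<W>"
    and residues_simply_connected: "U \<subseteq> W \<Longrightarrow> flag \<Gamma> U \<Longrightarrow> U \<notin> \<W> \<Longrightarrow>
      simply_connected_pregeom (residue \<Gamma> U)"
begin

lemma shape_flag: "V \<in> \<W> \<Longrightarrow> V \<subseteq> W \<and> flag \<Gamma> V"
  using shape by (simp add: shape_def)

lemma shape_up: "U \<in> \<W> \<Longrightarrow> V \<subseteq> W \<Longrightarrow> flag \<Gamma> V \<Longrightarrow> U \<subseteq> V \<Longrightarrow> V \<in> \<W>"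
  using shape unfolding shape_def by blast

lemma flag_elts: "flag \<Gamma> U \<Longrightarrow> U \<subseteq> elts \<Gamma>"
  by (simp add: flag_def)

lemma types_decrease:
  assumes "w \<in> elts (residue \<Gamma> U)"
  shows "card (I - type_of \<Gamma> ` insert w U) < card (I - type_of \<Gamma> ` U)"
  using assms finite_types type_closed by (intro psubset_card_mono) (auto simp: elts_residue)

lemma residue_flag_insert:
  assumes "U \<subseteq> W" "w \<in> W \<inter> elts (residue \<Gamma> U)"
  shows "insert w U \<subseteq> W" "flag \<Gamma> (insert w U)"
  using assms by (auto simp: elts_residue)

text \<open>Induction on the number of types missing in \<open>U\<close>. If \<open>U\<close> is not in the shape, its residue is
  connected, so that the stabilizer of \<open>U\<close> is generated by the stabilizers of larger flags. If the
  residue is empty, then the geometry is a single chamber and \<open>G\<close> is trivial. Besides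
  surjectivity, this gives the uniqueness of extensions of homomorphisms.\<close>

lemma shape_stabilizers_generate:
  assumes S: "subgroup S (subaut \<Gamma> G)"
    and "U \<subseteq> W" "flag \<Gamma> U"
    and "\<And>V. V \<in> \<W> \<Longrightarrow> U \<subseteq> V \<Longrightarrow> flag_stabilizer G V \<subseteq> S"
  shows "flag_stabilizer G U \<subseteq> S"
  using assms(2-)
proof (induction "card (I - type_of \<Gamma> ` U)" arbitrary: U rule: less_induct)
  case less
  note UW = less.prems(1) and U = less.prems(2)
  show ?case
  proof (cases "U \<in> \<W>")
    case True
    then show ?thesis using less.prems(3) by blast
  next
    case False
    show ?thesis
    proof (cases "elts (residue \<Gamma> U) = {}")
      case True
      have "F \<notin> \<W>" if "F \<subseteq> U" for F
        using shape_up[OF _ UW U that] False by blast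
      then have "connected_pregeom (residue \<Gamma> F)" if "F \<subseteq> U" for F
        using residues_simply_connected[of F] that UW flag_subset[OF U that]
        by (auto simp: simply_connected_pregeom_def)
      then have "elts \<Gamma> \<subseteq> U"
        by (rule connected_residues_single_chamber[OF U residue_empty_types[OF U True]])
      then have "g = \<one>\<^bsub>aut_group \<Gamma>\<^esub>" if "g \<in> G" for g
        using single_chamber_trivial[OF U _ that] by blast
      then show ?thesis
        using subgroup.one_closed[OF S] by (auto simp: flag_stabilizer_def)
    next
      case nonempty: False
      let ?K = "subaut \<Gamma> (flag_stabilizer G U)"
      interpret K: strict_fundamental_domain ?K "\<lambda>g. g" "residue \<Gamma> U"
        "type_of \<Gamma> ` elts (residue \<Gamma> U)" "W \<inter> elts (residue \<Gamma> U)"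
        by (rule residue_domain[OF UW U])
      interpret A: group "subaut \<Gamma> G" by (rule group_subaut)
      have "subgroup (S \<inter> flag_stabilizer G U) (subaut \<Gamma> G)"
        using S subgroup_flag_stabilizer[OF flag_elts[OF U]] by (rule A.subgroups_Inter_pair)
      then have "subgroup (S \<inter> flag_stabilizer G U) ?K"
        using A.subgroup_incl[OF _ subgroup_flag_stabilizer[OF flag_elts[OF U]]] by simp
      moreover have "flag_stabilizer G (insert w U) \<subseteq> S \<inter> flag_stabilizer G U"
        if w: "w \<in> W \<inter> elts (residue \<Gamma> U)" for w
      proof -
        have "flag_stabilizer G (insert w U) \<subseteq> S"
          using less.hyps[OF types_decrease residue_flag_insert[OF UW w]] w less.prems(3) by blast
        then show ?thesis using flag_stabilizer_mono[of U "insert w U"] by blast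
      qed
      ultimately have "carrier ?K \<subseteq> S \<inter> flag_stabilizer G U"
        using residues_simply_connected[OF UW U False] nonempty
        by (intro K.stabilizers_generate) (auto simp: simply_connected_pregeom_def stabilizer_in_residue)
      then show ?thesis by simp
    qed
  qed
qed

text \<open>Again by induction on the number of types missing in \<open>U\<close>. For \<open>U\<close> outside of the shape, the
  extensions to the stabilizers of the flags \<open>insert w U\<close> exist inductively, and the extension
  theorem over the simply connected residue of \<open>U\<close> glues them.\<close>

lemma shape_homs_extend:
  assumes H: "group H"
    and f_hom: "\<And>V. V \<in> \<W> \<Longrightarrow> f V \<in> hom (subaut \<Gamma> (flag_stabilizer G V)) H"
    and f_compat: "\<And>V V' g. V \<in> \<W> \<Longrightarrow> V' \<in> \<W> \<Longrightarrow> V \<subseteq> V' \<Longrightarrow>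
      g \<in> flag_stabilizer G V' \<Longrightarrow> f V g = f V' g"
    and "U \<subseteq> W" "flag \<Gamma> U"
  shows "\<exists>F\<in>hom (subaut \<Gamma> (flag_stabilizer G U)) H.
    \<forall>V\<in>\<W>. U \<subseteq> V \<longrightarrow> (\<forall>g\<in>flag_stabilizer G V. F g = f V g)"
  using assms(4-)
proof (induction "card (I - type_of \<Gamma> ` U)" arbitrary: U rule: less_induct)
  case less
  note UW = less.prems(1) and U = less.prems(2)
  show ?case
  proof (cases "U \<in> \<W>")
    case True
    then show ?thesis using f_hom[OF True] f_compat[OF True] by blast
  next
    case False
    let ?K = "subaut \<Gamma> (flag_stabilizer G U)" and ?\<Delta> = "residue \<Gamma> U"
    let ?D = "W \<inter> elts ?\<Delta>"
    interpret K: strict_fundamental_domain ?K "\<lambda>g. g" ?\<Delta> "type_of \<Gamma> ` elts ?\<Delta>" ?D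
      by (rule residue_domain[OF UW U])
    have "\<forall>w\<in>?D. \<exists>F. F \<in> hom (subaut \<Gamma> (flag_stabilizer G (insert w U))) H \<and>
      (\<forall>V\<in>\<W>. insert w U \<subseteq> V \<longrightarrow> (\<forall>g\<in>flag_stabilizer G V. F g = f V g))"
    proof
      fix w assume w: "w \<in> ?D"
      then have "w \<in> elts ?\<Delta>" by simp
      from less.hyps[OF types_decrease[OF this] residue_flag_insert[OF UW w]]
      show "\<exists>F. F \<in> hom (subaut \<Gamma> (flag_stabilizer G (insert w U))) H \<and>
        (\<forall>V\<in>\<W>. insert w U \<subseteq> V \<longrightarrow> (\<forall>g\<in>flag_stabilizer G V. F g = f V g))"
        by (rule bexE) blast
    qed
    then obtain F where F: "\<forall>w\<in>?D. F w \<in> hom (subaut \<Gamma> (flag_stabilizer G (insert w U))) H \<and>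
      (\<forall>V\<in>\<W>. insert w U \<subseteq> V \<longrightarrow> (\<forall>g\<in>flag_stabilizer G V. F w g = f V g))"
      by (elim bchoice[THEN exE])
    have F_hom: "F w \<in> hom (subaut \<Gamma> (flag_stabilizer G (insert w U))) H" if "w \<in> ?D" for w
      using F that by blast
    have F_f: "F w g = f V g"
      if "w \<in> ?D" "V \<in> \<W>" "insert w U \<subseteq> V" "g \<in> flag_stabilizer G V" for w V g
      using F that by blast
    \<comment> \<open>On the stabilizer of \<open>U \<union> {w, w'}\<close> both homomorphisms extend the given ones, so they
      agree on a generating set.\<close>
    have F_compat: "F w a = F w' a"
      if w: "w \<in> ?D" and w': "w' \<in> ?D" and inc: "(w, w') \<in> incid ?\<Delta>"
        and a: "a \<in> flag_stabilizer G (insert w U)" "a \<in> flag_stabilizer G (insert w' U)" for w w' a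
    proof -
      let ?E = "U \<union> {w, w'}"
      have "flag ?\<Delta> {w, w'}"
        using inc w w' pregeometryD(3)[OF pregeometry_residue[OF pregeom] inc]
          pregeometryD(2)[OF pregeometry_residue[OF pregeom]] by (simp add: flag_def)
      then have E: "flag \<Gamma> ?E" "?E \<subseteq> W"
        using flag_residue_union[OF U] w w' UW by blast+
      interpret A: group "subaut \<Gamma> G" by (rule group_subaut)
      interpret L: group "subaut \<Gamma> (flag_stabilizer G ?E)"
        by (rule group_flag_stabilizer[OF flag_elts[OF E(1)]])
      have "flag_stabilizer G ?E \<subseteq> flag_stabilizer G (insert w U)"
        "flag_stabilizer G ?E \<subseteq> flag_stabilizer G (insert w' U)"
        by (intro flag_stabilizer_mono; blast)+
      then have homs: "F w \<in> hom (subaut \<Gamma> (flag_stabilizer G ?E)) H"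
        "F w' \<in> hom (subaut \<Gamma> (flag_stabilizer G ?E)) H"
        using hom_restrict_carrier F_hom[OF w] F_hom[OF w'] by blast+
      let ?S = "{a \<in> carrier (subaut \<Gamma> (flag_stabilizer G ?E)). F w a = F w' a}"
      have "subgroup ?S (subaut \<Gamma> (flag_stabilizer G ?E))"
        using L.subgroup_equalizer[OF H homs] .
      then have "subgroup ?S (subaut \<Gamma> G)"
        using A.incl_subgroup[OF subgroup_flag_stabilizer[OF flag_elts[OF E(1)]]] by simp
      moreover have "flag_stabilizer G V \<subseteq> ?S" if V: "V \<in> \<W>" "?E \<subseteq> V" for V
      proof
        fix g assume g: "g \<in> flag_stabilizer G V"
        have "F w g = f V g" "F w' g = f V g"
          using F_f[OF w V(1) _ g] F_f[OF w' V(1) _ g] V(2) by auto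
        then show "g \<in> ?S" using flag_stabilizer_mono[OF V(2)] g by auto
      qed
      ultimately have "flag_stabilizer G ?E \<subseteq> ?S"
        using shape_stabilizers_generate[OF _ E(2,1)] by blast
      moreover have "a \<in> flag_stabilizer G ?E" using a by (auto simp: flag_stabilizer_def)
      ultimately show ?thesis by blast
    qed
    have "compatible_stabilizer_homs ?K (\<lambda>g. g) ?\<Delta> (type_of \<Gamma> ` elts ?\<Delta>) ?D H F"
    proof (intro compatible_stabilizer_homs.intro compatible_stabilizer_homs_axioms.intro)
      show "strict_fundamental_domain ?K (\<lambda>g. g) ?\<Delta> (type_of \<Gamma> ` elts ?\<Delta>) ?D"
        by (rule residue_domain[OF UW U])
    qed (use H F_hom F_compat in \<open>simp_all add: stabilizer_in_residue\<close>)
    from compatible_stabilizer_homs.simply_connected_extension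
      [OF this residues_simply_connected[OF UW U False], unfolded stabilizer_in_residue]
    obtain E where E: "E \<in> hom ?K H"
      and EF: "\<forall>w\<in>?D. \<forall>a\<in>flag_stabilizer G (insert w U). E a = F w a"
      by (rule bexE)
    have "E g = f V g" if V: "V \<in> \<W>" "U \<subseteq> V" and g: "g \<in> flag_stabilizer G V" for V g
    proof -
      have "V \<noteq> U" using V(1) False by auto
      then obtain w where w: "w \<in> V" "w \<notin> U" using V(2) by blast
      have wD: "w \<in> ?D"
        using flag_elt_residue[OF _ V(2) w] shape_flag[OF V(1)] w by blast
      have sub: "insert w U \<subseteq> V" using V(2) w by simp
      have "E g = F w g" using EF wD flag_stabilizer_mono[OF sub] g by blast
      also have "F w g = f V g" using F_f[OF wD V(1) sub g] .
      finally show ?thesis .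
    qed
    with E show ?thesis by blast
  qed
qed


section \<open>The universal completion\<close>

abbreviation amalg :: "('a set, 'a \<Rightarrow> 'a) amalgam" where
  "amalg \<equiv> shape_amalgam \<Gamma> G \<W>"

lemma gens_iff: "(V, g) \<in> amalgam_gens amalg \<longleftrightarrow> V \<in> \<W> \<and> g \<in> flag_stabilizer G V"
  by (simp add: amalgam_gens_def shape_amalgam_def)

lemma shape_stabilizer_mult:
  assumes "V \<in> \<W>" "x \<in> flag_stabilizer G V" "y \<in> flag_stabilizer G V"
  shows "x \<otimes>\<^bsub>aut_group \<Gamma>\<^esub> y \<in> flag_stabilizer G V"
  using subgroup.m_closed[OF subgroup_flag_stabilizer] flag_elts shape_flag assms by fastforce

lemma rels_cases:
  assumes "(r, r') \<in> amalgam_rels amalg"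
  obtains (mult) V x y where "V \<in> \<W>" "x \<in> flag_stabilizer G V" "y \<in> flag_stabilizer G V"
      "r = [(True, V, x), (True, V, y)]" "r' = [(True, V, x \<otimes>\<^bsub>aut_group \<Gamma>\<^esub> y)]"
    | (ident) V V' x where "V \<in> \<W>" "V' \<in> \<W>" "V \<subseteq> V'" "x \<in> flag_stabilizer G V'"
      "r = [(True, V', x)]" "r' = [(True, V, x)]"
  using assms by (auto simp: amalgam_rels_def shape_amalgam_def)

lemma rels_mult:
  "V \<in> \<W> \<Longrightarrow> x \<in> flag_stabilizer G V \<Longrightarrow> y \<in> flag_stabilizer G V \<Longrightarrow>
    ([(True, V, x), (True, V, y)], [(True, V, x \<otimes>\<^bsub>aut_group \<Gamma>\<^esub> y)]) \<in> amalgam_rels amalg"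
  by (auto simp: amalgam_rels_def shape_amalgam_def)

lemma rels_ident:
  "V \<in> \<W> \<Longrightarrow> V' \<in> \<W> \<Longrightarrow> V \<subseteq> V' \<Longrightarrow> x \<in> flag_stabilizer G V' \<Longrightarrow>
    ([(True, V', x)], [(True, V, x)]) \<in> amalgam_rels amalg"
  by (auto simp: amalgam_rels_def shape_amalgam_def)

sublocale presentation "amalgam_gens amalg" "amalgam_rels amalg"
proof
  show "amalgam_rels amalg \<subseteq> words (amalgam_gens amalg) \<times> words (amalgam_gens amalg)"
  proof (rule subrelI)
    fix r r' assume "(r, r') \<in> amalgam_rels amalg"
    then show "(r, r') \<in> words (amalgam_gens amalg) \<times> words (amalgam_gens amalg)"
    proof (cases rule: rels_cases)
      case (mult V x y)
      then show ?thesis using shape_stabilizer_mult by (simp add: gens_iff)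
    next
      case (ident V V' x)
      then show ?thesis using flag_stabilizer_mono[of V V'] by (auto simp: gens_iff)
    qed
  qed
qed

sublocale to_group: presentation_assignment "amalgam_gens amalg" "amalgam_rels amalg" "subaut \<Gamma> G" snd
proof (intro presentation_assignment.intro presentation_assignment_axioms.intro
    presentation_axioms group_subaut)
  interpret group "subaut \<Gamma> G" by (rule group_subaut)
  show "snd \<in> amalgam_gens amalg \<rightarrow> carrier (subaut \<Gamma> G)"
    by (auto simp: gens_iff flag_stabilizer_def)
  fix r r' assume "(r, r') \<in> amalgam_rels amalg"
  then show "eval_word (subaut \<Gamma> G) snd r = eval_word (subaut \<Gamma> G) snd r'"
  proof (cases rule: rels_cases)
    case (mult V x y)
    then have "x \<in> carrier (subaut \<Gamma> G)" "y \<in> carrier (subaut \<Gamma> G)"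
      by (auto simp: flag_stabilizer_def)
    from m_assoc[OF this one_closed] r_one[OF m_closed[OF this]] show ?thesis
      using mult by simp
  qed simp
qed

lemma completion_hom_class:
  assumes "p \<in> words (amalgam_gens amalg)"
  shows "completion_hom amalg (subaut \<Gamma> G) snd (word_class p) = eval_word (subaut \<Gamma> G) snd p"
  using to_group.the_elem_eval_word_class[OF assms] by (simp add: completion_hom_def)

text \<open>The groups of the amalgam map compatibly to its universal completion, and these maps extend
  to a homomorphism on all of \<open>G\<close>, the stabilizer of the empty flag. It is a left inverse of the
  canonical homomorphism, as one sees on generators. The latter is surjective as its image
  contains the generating stabilizers.\<close>

theorem universal_completion_shape: "is_universal_completion (subaut \<Gamma> G) amalg"
proof -
  let ?U = "universal_completion amalg" and ?\<pi> = "completion_hom amalg (subaut \<Gamma> G) snd"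
  let ?S = "amalgam_gens amalg"
  have U_eq: "?U = presented_group ?S (amalgam_rels amalg)"
    by (simp add: universal_completion_def)
  have U: "group ?U" unfolding U_eq by (rule group_presented)
  have \<pi>: "?\<pi> \<in> hom ?U (subaut \<Gamma> G)"
    using to_group.presented_hom by (simp add: U_eq completion_hom_def[abs_def])
  let ?f = "\<lambda>V g. word_class [(True, V, g)]"
  have f_closed: "?f V g \<in> carrier ?U" if "V \<in> \<W>" "g \<in> flag_stabilizer G V" for V g
    unfolding U_eq using that by (intro word_class_closed) (simp add: gens_iff)
  have class_eq: "word_class r = word_class r'" if "(r, r') \<in> amalgam_rels amalg" for r r'
  proof -
    have "word_step ?S (amalgam_rels amalg) ([] @ r @ []) ([] @ r' @ [])"
      using that by (intro word_step.relation) auto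
    then have "(r, r') \<in> word_equiv ?S (amalgam_rels amalg)"
      using word_equiv_step by simp
    then show ?thesis by (rule equiv_class_eq[OF equiv_word_equiv])
  qed
  have f_hom: "?f V \<in> hom (subaut \<Gamma> (flag_stabilizer G V)) ?U" if V: "V \<in> \<W>" for V
  proof (rule homI)
    fix x y assume "x \<in> carrier (subaut \<Gamma> (flag_stabilizer G V))"
      "y \<in> carrier (subaut \<Gamma> (flag_stabilizer G V))"
    then have xy: "x \<in> flag_stabilizer G V" "y \<in> flag_stabilizer G V" by simp_all
    then have "?f V x \<otimes>\<^bsub>?U\<^esub> ?f V y = word_class ([(True, V, x)] @ [(True, V, y)])"
      unfolding U_eq using V by (intro mult_presented) (simp_all add: gens_iff)
    also have "\<dots> = ?f V (x \<otimes>\<^bsub>aut_group \<Gamma>\<^esub> y)"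
      using class_eq[OF rels_mult[OF V xy]] by simp
    finally show "?f V (x \<otimes>\<^bsub>subaut \<Gamma> (flag_stabilizer G V)\<^esub> y) = ?f V x \<otimes>\<^bsub>?U\<^esub> ?f V y"
      by simp
  qed (use f_closed[OF V] in simp)
  have f_compat: "?f V g = ?f V' g"
    if "V \<in> \<W>" "V' \<in> \<W>" "V \<subseteq> V'" "g \<in> flag_stabilizer G V'" for V V' g
    using class_eq[OF rels_ident[OF that]] by (rule sym)
  have empty: "{} \<subseteq> W" "flag \<Gamma> {}" by (simp_all add: flag_def)
  obtain \<Phi> where \<Phi>: "\<Phi> \<in> hom (subaut \<Gamma> G) ?U"
    and \<Phi>f: "\<And>V g. V \<in> \<W> \<Longrightarrow> g \<in> flag_stabilizer G V \<Longrightarrow> \<Phi> g = ?f V g"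
    using shape_homs_extend[OF U f_hom f_compat empty] unfolding flag_stabilizer_empty by blast
  \<comment> \<open>Homomorphisms commute with evaluation of words.\<close>
  have left_inverse: "\<Phi> (?\<pi> (word_class p)) = word_class p" if p: "p \<in> words ?S" for p
  proof -
    have "\<Phi> (?\<pi> (word_class p)) = eval_word ?U (\<lambda>s. \<Phi> (snd s)) p"
      unfolding completion_hom_class[OF p]
      by (rule group.hom_eval_word[OF group_subaut U \<Phi> to_group.gens_closed p])
    also have "\<dots> = eval_word ?U (\<lambda>s. word_class [(True, s)]) p"
    proof (rule eval_word_cong[OF _ p])
      fix s assume "s \<in> ?S"
      then show "\<Phi> (snd s) = word_class [(True, s)]"
        by (cases s) (simp add: gens_iff \<Phi>f)
    qed
    also have "\<dots> = word_class p" unfolding U_eq by (rule eval_word_classes[OF p])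
    finally show ?thesis .
  qed
  have inj: "inj_on ?\<pi> (carrier ?U)"
  proof (rule inj_on_inverseI)
    fix x assume "x \<in> carrier ?U"
    then obtain p where "x = word_class p" "p \<in> words ?S"
      unfolding U_eq by (rule presented_group_cases)
    then show "\<Phi> (?\<pi> x) = x" using left_inverse by simp
  qed
  have "subgroup (?\<pi> ` carrier ?U) (subaut \<Gamma> G)"
    using U group_subaut \<pi>
    by (intro group_hom.img_is_subgroup) (simp add: group_hom_def group_hom_axioms_def)
  moreover have "flag_stabilizer G V \<subseteq> ?\<pi> ` carrier ?U" if V: "V \<in> \<W>" for V
  proof
    fix g assume g: "g \<in> flag_stabilizer G V"
    then have "g \<in> carrier (subaut \<Gamma> G)" by (simp add: flag_stabilizer_def)
    then have "?\<pi> (?f V g) = g"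
      using completion_hom_class[of "[(True, V, g)]"] V g to_group.r_one[of g] by (simp add: gens_iff)
    then show "g \<in> ?\<pi> ` carrier ?U" using f_closed[OF V g] by force
  qed
  ultimately have "G \<subseteq> ?\<pi> ` carrier ?U"
    using shape_stabilizers_generate[OF _ empty] unfolding flag_stabilizer_empty by blast
  then have "?\<pi> ` carrier ?U = carrier (subaut \<Gamma> G)"
    using \<pi> by (auto simp: hom_def)
  with inj \<pi> show ?thesis
    by (simp add: is_universal_completion_def iso_def bij_betw_def)
qed

end

text \<open>Both completions map isomorphically to \<open>G\<close>, and the canonical map between them is compatible
  with these isomorphisms.\<close>

theorem same_completion_subshape:
  assumes A: "hall_shape I \<Gamma> G W \<A>" and B: "hall_shape I \<Gamma> G W \<B>" and sub: "\<A> \<subseteq> \<B>"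
  shows "same_completion (shape_amalgam \<Gamma> G \<B>) (shape_amalgam \<Gamma> G \<A>)"
proof -
  interpret A: hall_shape I \<Gamma> G W \<A> by (rule A)
  interpret B: hall_shape I \<Gamma> G W \<B> by (rule B)
  let ?UA = "universal_completion A.amalg" and ?UB = "universal_completion B.amalg"
  let ?\<pi>A = "completion_hom A.amalg (subaut \<Gamma> G) snd"
    and ?\<pi>B = "completion_hom B.amalg (subaut \<Gamma> G) snd"
    and ?\<kappa> = "completion_hom A.amalg ?UB (completion_gen B.amalg)"
  have UA: "?UA = presented_group (amalgam_gens A.amalg) (amalgam_rels A.amalg)"
    and UB: "?UB = presented_group (amalgam_gens B.amalg) (amalgam_rels B.amalg)"
    by (simp_all add: universal_completion_def)
  have gens: "amalgam_gens A.amalg \<subseteq> amalgam_gens B.amalg"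
    using sub by (auto simp: amalgam_gens_def shape_amalgam_def)
  have rels: "amalgam_rels A.amalg \<subseteq> amalgam_rels B.amalg"
  proof (rule subrelI)
    fix r r' assume "(r, r') \<in> amalgam_rels A.amalg"
    then show "(r, r') \<in> amalgam_rels B.amalg"
      by (cases rule: A.rels_cases) (use sub B.rels_mult B.rels_ident in blast)+
  qed
  have words: "p \<in> words (amalgam_gens B.amalg)" if "p \<in> words (amalgam_gens A.amalg)" for p
    using that gens by (auto simp: in_lists_conv_set)
  have eval: "eval_word ?UB (completion_gen B.amalg) p = B.word_class p"
    if "p \<in> words (amalgam_gens B.amalg)" for p
    using B.eval_word_classes[OF that] by (simp add: UB completion_gen_def[abs_def])
  interpret \<kappa>: presentation_assignment "amalgam_gens A.amalg" "amalgam_rels A.amalg" ?UB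
    "completion_gen B.amalg"
  proof (intro presentation_assignment.intro presentation_assignment_axioms.intro
      A.presentation_axioms)
    show "group ?UB" unfolding UB by (rule B.group_presented)
    show "completion_gen B.amalg \<in> amalgam_gens A.amalg \<rightarrow> carrier ?UB"
      using gens unfolding UB completion_gen_def by (auto intro!: B.word_class_closed)
    fix r r' assume r: "(r, r') \<in> amalgam_rels A.amalg"
    then have rw: "r \<in> words (amalgam_gens B.amalg)" "r' \<in> words (amalgam_gens B.amalg)"
      using rels B.rels_words by auto
    have "word_step (amalgam_gens B.amalg) (amalgam_rels B.amalg) ([] @ r @ []) ([] @ r' @ [])"
      using r rels by (intro word_step.relation) auto
    then have "(r, r') \<in> word_equiv (amalgam_gens B.amalg) (amalgam_rels B.amalg)"
      using B.word_equiv_step by simp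
    then show "eval_word ?UB (completion_gen B.amalg) r = eval_word ?UB (completion_gen B.amalg) r'"
      unfolding eval[OF rw(1)] eval[OF rw(2)] by (rule equiv_class_eq[OF B.equiv_word_equiv])
  qed
  have \<kappa>: "?\<kappa> \<in> hom ?UA ?UB"
    using \<kappa>.presented_hom by (simp add: UA completion_hom_def[abs_def])
  have factor: "?\<pi>B (?\<kappa> x) = ?\<pi>A x" if x: "x \<in> carrier ?UA" for x
  proof -
    obtain p where xp: "x = A.word_class p" and p: "p \<in> words (amalgam_gens A.amalg)"
      using x unfolding UA by (rule A.presented_group_cases)
    have "?\<kappa> x = B.word_class p"
      unfolding xp completion_hom_def \<kappa>.the_elem_eval_word_class[OF p] by (rule eval[OF words[OF p]])
    then show ?thesis
      unfolding xp A.completion_hom_class[OF p] using B.completion_hom_class[OF words[OF p]] by simp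
  qed
  have \<pi>A: "bij_betw ?\<pi>A (carrier ?UA) (carrier (subaut \<Gamma> G))"
    and \<pi>B: "bij_betw ?\<pi>B (carrier ?UB) (carrier (subaut \<Gamma> G))"
    using A.universal_completion_shape B.universal_completion_shape
    by (simp_all add: is_universal_completion_def iso_def)
  have "bij_betw (?\<pi>B \<circ> ?\<kappa>) (carrier ?UA) (carrier (subaut \<Gamma> G))"
    using \<pi>A factor by (simp cong: bij_betw_cong)
  then have "bij_betw ?\<kappa> (carrier ?UA) (carrier ?UB)"
    using \<kappa> \<pi>B by (subst bij_betw_comp_iff2[of ?\<pi>B]) (auto simp: hom_def)
  with \<kappa> show ?thesis by (simp add: same_completion_def iso_def)
qed

theorem theorem3p3:
  fixes I :: "'i set"
    and \<Gamma> :: "('a, 'i) pregeom"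
    and G :: "('a \<Rightarrow> 'a) set"
    and t :: "'i \<Rightarrow> nat"
    and w :: "'i \<Rightarrow> nat \<Rightarrow> 'a"
    and W :: "'a set"
    and \<W> :: "'a set set"
  assumes "finite I"
    and "geometry I \<Gamma>"
    and "subgroup G (aut_group \<Gamma>)"
    and "\<And>i. i \<in> I \<Longrightarrow> orbit_representatives \<Gamma> G i (t i) (w i)"
    and "W = (\<Union>i\<in>I. w i ` {1..t i})"
    and "hall I \<Gamma> W"
    and "\<And>V. V \<subseteq> W \<Longrightarrow> flag \<Gamma> V \<Longrightarrow>
           flag_transitive_on G (induced_pregeom \<Gamma> (\<Union>x\<in>V. aut_orbit \<Gamma> G x))"
    and "shape \<Gamma> W \<W>"
    and "\<And>U. U \<subseteq> W \<Longrightarrow> flag \<Gamma> U \<Longrightarrow> U \<notin> \<W> \<Longrightarrow> simply_connected_pregeom (residue \<Gamma> U)"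
  shows "is_universal_completion (subaut \<Gamma> G) (shape_amalgam \<Gamma> G \<W>) \<and>
         ({} \<notin> \<W> \<longrightarrow>
            is_universal_completion (subaut \<Gamma> G) (parabolic_amalgam \<Gamma> G W) \<and>
            same_completion (parabolic_amalgam \<Gamma> G W) (shape_amalgam \<Gamma> G \<W>))"
proof -
  have orbit_iff: "x \<in> aut_orbit \<Gamma> G y \<longleftrightarrow> (\<exists>g\<in>G. g y = x)" for x y
    by (auto simp: orbit_def)
  have pregeom: "pregeometry I \<Gamma>" using assms(2) by (simp add: geometry_def)
  have reps: "w i j \<in> elts \<Gamma>" "type_of \<Gamma> (w i j) = i" if "i \<in> I" "j \<in> {1..t i}" for i j
    using assms(4)[OF that(1)] that(2) by (auto simp: orbit_representatives_def)
  have rep_ex1: "\<exists>!j. j \<in> {1..t (type_of \<Gamma> x)} \<and> x \<in> aut_orbit \<Gamma> G (w (type_of \<Gamma> x) j)"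
    if x: "x \<in> elts \<Gamma>" for x
  proof -
    have "type_of \<Gamma> x \<in> I" using pregeom x by (auto simp: pregeometry_def)
    from assms(4)[OF this] x show ?thesis by (simp add: orbit_representatives_def)
  qed
  have action: "hall_action I \<Gamma> G W"
  proof (rule hall_action.intro)
    fix x assume x: "x \<in> elts \<Gamma>"
    then have I: "type_of \<Gamma> x \<in> I" using pregeom by (auto simp: pregeometry_def)
    obtain j where "j \<in> {1..t (type_of \<Gamma> x)}" "x \<in> aut_orbit \<Gamma> G (w (type_of \<Gamma> x) j)"
      using rep_ex1[OF x] by blast
    then show "\<exists>w\<in>W. \<exists>g\<in>G. g w = x" using I unfolding assms(5) orbit_iff by blast
  next
    fix g v assume g: "g \<in> G" and v: "v \<in> W" "g v \<in> W"
    obtain i j where ij: "i \<in> I" "j \<in> {1..t i}" "v = w i j" using v(1) unfolding assms(5) by blast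
    obtain i' j' where ij': "i' \<in> I" "j' \<in> {1..t i'}" "g v = w i' j'"
      using v(2) unfolding assms(5) by blast
    have "type_of \<Gamma> (g v) = type_of \<Gamma> v"
      using g reps[OF ij(1,2)] subgroup.subset[OF assms(3)] unfolding ij(3) carrier_aut_group by blast
    then have i: "i' = i" using reps[OF ij(1,2)] reps[OF ij'(1,2)] ij ij' by simp
    have "g v \<in> aut_orbit \<Gamma> G (w i j)" using g ij(3) unfolding orbit_iff by blast
    moreover have "g v \<in> aut_orbit \<Gamma> G (w i j')"
      using aut_group_one[of "w i' j'" \<Gamma>] reps[OF ij'(1,2)] subgroup.one_closed[OF assms(3)] ij'(3) i
      unfolding orbit_iff by metis
    moreover have "g v \<in> elts \<Gamma>" "type_of \<Gamma> (g v) = i" using reps[OF ij'(1,2)] ij'(3) i by simp_all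
    \<comment> \<open>Both indices name a representative of the orbit of \<open>g v\<close>.\<close>
    ultimately have "j' = j" using rep_ex1[of "g v"] ij(2) ij'(2) i by blast
    then show "g v = v" using ij(3) ij'(3) i by simp
  qed (fact assms)+
  have shape: "hall_shape I \<Gamma> G W \<W>"
    by (intro hall_shape.intro hall_shape_axioms.intro action assms(8) assms(9))
  show ?thesis
  proof (intro conjI impI)
    show "is_universal_completion (subaut \<Gamma> G) (shape_amalgam \<Gamma> G \<W>)"
      by (rule hall_shape.universal_completion_shape[OF shape])
    assume empty: "{} \<notin> \<W>"
    let ?P = "{U. U \<subseteq> W \<and> flag \<Gamma> U \<and> U \<noteq> {}}"
    have parabolic: "hall_shape I \<Gamma> G W ?P"
    proof (intro hall_shape.intro hall_shape_axioms.intro action)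
      show "shape \<Gamma> W ?P" by (auto simp: shape_def)
      fix U assume "U \<subseteq> W" "flag \<Gamma> U" "U \<notin> ?P"
      then have "U \<notin> \<W>" using empty by auto
      then show "simply_connected_pregeom (residue \<Gamma> U)"
        using assms(9) \<open>U \<subseteq> W\<close> \<open>flag \<Gamma> U\<close> by blast
    qed
    show "is_universal_completion (subaut \<Gamma> G) (parabolic_amalgam \<Gamma> G W)"
      unfolding parabolic_amalgam_def by (rule hall_shape.universal_completion_shape[OF parabolic])
    have "\<W> \<subseteq> ?P" using assms(8) empty by (auto simp: shape_def)
    then show "same_completion (parabolic_amalgam \<Gamma> G W) (shape_amalgam \<Gamma> G \<W>)"
      unfolding parabolic_amalgam_def by (rule same_completion_subshape[OF shape parabolic])
  qed
qed

end
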